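(* Let $W$ be a Wiener process, $S_t=\sup_{s\le t}W_s$ its running maximum, and $L^0(W)$ its local time at zero. Then the following equality in distribution of (two-dimensional) processes holds: $$(S-W,\;S)\stackrel{d}{=}\bigl(|W|,\;L^0(W)\bigr).$$
   Context: $W$ is a standard one-dimensional Wiener process with $W_0=0$. Its local time $L_t^x=L_t^x(W)$ is the density with respect to Lebesgue measure of the occupation measure $T_t(A)=\int_0^t I_A(W_s)\,ds$ ($A\subseteq\mathbb{R}$ Borel), taken in its version that is almost surely jointly continuous in $(t,x)$; equivalently $L_t^x=\lim_{\epsilon\downarrow0}\frac{1}{2\epsilon}\int_0^t I\{x-\epsilon\le W_s\le x+\epsilon\}\,ds$. *)

theory Defs
  imports "HOL-Probability.Probability"
begin

text \<open>Processes are indexed by \<open>real\<close>; only their values at times \<open>t \<ge> 0\<close> are meaningful, and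
  every condition below is restricted to such times.\<close>

locale wiener_process = prob_space M for M :: "'a measure" +
  fixes W :: "real \<Rightarrow> 'a \<Rightarrow> real"
  assumes random_variable_W: "0 \<le> t \<Longrightarrow> W t \<in> borel_measurable M"
    and starts_at_0: "AE \<omega> in M. W 0 \<omega> = 0"
    and indep_increments:
      "0 \<le> \<tau> 0 \<Longrightarrow> (\<And>i. i < n \<Longrightarrow> \<tau> i < \<tau> (Suc i)) \<Longrightarrow>
        indep_vars (\<lambda>_. borel) (\<lambda>i \<omega>. W (\<tau> (Suc i)) \<omega> - W (\<tau> i) \<omega>) {..<n::nat}"
    and normal_increments:
      "0 \<le> s \<Longrightarrow> s < t \<Longrightarrow>
        distributed M lborel (\<lambda>\<omega>. W t \<omega> - W s \<omega>) (\<lambda>x. ennreal (normal_density 0 (sqrt (t - s)) x))"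
    and continuous_paths: "AE \<omega> in M. continuous_on {0..} (\<lambda>t. W t \<omega>)"

text \<open>Paths are only required to be continuous almost surely, so the supremum is a random variable
  with respect to the completion of \<open>M\<close>, but not necessarily with respect to \<open>M\<close>.\<close>

definition running_max :: "(real \<Rightarrow> 'a \<Rightarrow> real) \<Rightarrow> real \<Rightarrow> 'a \<Rightarrow> real" where
  "running_max W t \<omega> = (SUP s\<in>{0..t}. W s \<omega>)"

definition occupation :: "(real \<Rightarrow> 'a \<Rightarrow> real) \<Rightarrow> real \<Rightarrow> 'a \<Rightarrow> real set \<Rightarrow> ennreal" where
  "occupation W t \<omega> A = (\<integral>\<^sup>+s\<in>{0..t}. indicator A (W s \<omega>) \<partial>lborel)"

text \<open>\<open>L t x\<close> is the local time at level \<open>x\<close> up to time \<open>t\<close>. Nonnegativity has to be stated, since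
  \<open>ennreal\<close> maps negative reals to \<open>0\<close>. Joint continuity determines \<open>L\<close> up to a null set
  (simultaneously for all \<open>t \<ge> 0\<close> and \<open>x\<close>).\<close>

definition is_local_time ::
    "'a measure \<Rightarrow> (real \<Rightarrow> 'a \<Rightarrow> real) \<Rightarrow> (real \<Rightarrow> real \<Rightarrow> 'a \<Rightarrow> real) \<Rightarrow> bool" where
  "is_local_time M W L \<longleftrightarrow>
     (\<forall>t\<ge>0. \<forall>x. L t x \<in> borel_measurable M) \<and>
     (AE \<omega> in M. continuous_on ({0..} \<times> UNIV) (\<lambda>(t, x). L t x \<omega>)) \<and>
     (AE \<omega> in M. \<forall>t\<ge>0. (\<forall>x. 0 \<le> L t x \<omega>) \<and>
        (\<forall>A\<in>sets borel. occupation W t \<omega> A = (\<integral>\<^sup>+x\<in>A. ennreal (L t x \<omega>) \<partial>lborel)))"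

text \<open>Equality of the laws on the product \<open>\<sigma>\<close>-algebra over the time set \<open>[0, \<infinity>)\<close>. The
  measurability conditions rule out the degenerate value of \<^const>\<open>distr\<close> at a non-measurable map.\<close>

definition equal_in_law ::
    "'a measure \<Rightarrow> (real \<Rightarrow> 'a \<Rightarrow> 'c::topological_space) \<Rightarrow>
     'b measure \<Rightarrow> (real \<Rightarrow> 'b \<Rightarrow> 'c) \<Rightarrow> bool" where
  "equal_in_law M X N Y \<longleftrightarrow>
     (\<forall>t\<ge>0. X t \<in> borel_measurable M) \<and> (\<forall>t\<ge>0. Y t \<in> borel_measurable N) \<and>
     distr M (PiM {0..} (\<lambda>_. borel)) (\<lambda>\<omega>. \<lambda>t\<in>{0..}. X t \<omega>) =
     distr N (PiM {0..} (\<lambda>_. borel)) (\<lambda>\<omega>. \<lambda>t\<in>{0..}. Y t \<omega>)"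

end

theory Submission
  imports Defs
begin

text \<open>Sample \<open>W\<close> at the multiples of \<open>1/(m+1)\<close>, giving a Gaussian random walk \<open>X\<^sub>k\<close> with
  increments \<open>\<xi>\<^sub>k\<close>. By symmetry of the Gaussian law, the walk \<open>V\<close> with increments
  \<open>- sgn(X\<^sub>k) \<xi>\<^sub>k\<close> has the same law as \<open>X\<close>. The process \<open>\<Lambda>\<^sub>n = \<bar>X\<^sub>n\<bar> + V\<^sub>n\<close> is nondecreasing and grows
  only when \<open>X\<close> changes sign, so by a discrete form of Skorokhod's lemma it agrees with the running
  maximum of \<open>V\<close> up to the largest increment. Hence, writing \<open>max V\<close> for that running maximum,
  \<open>(\<bar>X\<bar>, \<Lambda>)\<close> is uniformly close to \<open>(max V - V, max V)\<close>, which has the same law as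
  \<open>(max X - X, max X)\<close>, and the latter converges to \<open>(S - W, S)\<close> by continuity of
  the paths. It remains to show that \<open>\<Lambda>\<close> converges in probability to the local time at \<open>0\<close>; this is a
  discrete Tanaka formula, obtained from the second order Taylor expansion of \<open>sqrt (x\<^sup>2 + e\<^sup>2)\<close>.\<close>

section \<open>Random walks and their reflections\<close>

text \<open>In continuous time the argument reads: |W| = \<integral> sgn(W) dW + L by Tanaka's
  formula, and - \<integral> sgn(W) dW is again a Wiener process, whose running maximum is L by
  Skorokhod's lemma. To avoid stochastic integrals, every probabilistic estimate is made for a
  finite Gaussian vector, where it is an induction with Fubini; the limit of vanishing mesh is only
  taken afterwards. Two parameters tend to 0, the mesh and the smoothing width e. The Taylor
  remainder carries a factor 1/e^2, so e is fixed while the mesh shrinks. The error of replacing the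
  sign by its smooth version is controlled by e alone; it is small because the occupation measure
  has a density and so does not charge the point 0. Convergence in probability at each fixed time is
  enough: laws on the product space are determined by finitely many times, and there they are tested
  with products of bounded Lipschitz functions.\<close>

definition sg :: "real \<Rightarrow> real" where
  "sg r = (if r < 0 then - 1 else 1)"

definition psum :: "(nat \<Rightarrow> real) \<Rightarrow> nat \<Rightarrow> real" where
  "psum x n = (\<Sum>i<n. x i)"

text \<open>The sign is read off before the step is made, so it is a function of the earlier
  increments only. It must never vanish, or the symmetry of the increment would not give back its
  law; this is why \<open>sg\<close> takes the value 1 at 0, where the walk starts.\<close>

definition flip :: "(nat \<Rightarrow> real) \<Rightarrow> nat \<Rightarrow> real" where
  "flip x j = - sg (psum x j) * x j"

fun pmax :: "(nat \<Rightarrow> real) \<Rightarrow> nat \<Rightarrow> real" where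
  "pmax x 0 = 0"
| "pmax x (Suc n) = max (pmax x n) (psum x (Suc n))"

text \<open>Tanaka's formula solved for the local time, with the stochastic integral of the sign
  replaced by its sum over the steps of the walk.\<close>

definition walk_ltime :: "(nat \<Rightarrow> real) \<Rightarrow> nat \<Rightarrow> real" where
  "walk_ltime x n = \<bar>psum x n\<bar> + psum (flip x) n"

lemma psum_0 [simp]: "psum x 0 = 0"
  and psum_Suc [simp]: "psum x (Suc n) = psum x n + x n"
  by (simp_all add: psum_def)

lemma psum_cong: "(\<And>i. i < n \<Longrightarrow> x i = y i) \<Longrightarrow> psum x n = psum y n"
  by (simp add: psum_def)

lemma flip_cong: "(\<And>i. i \<le> j \<Longrightarrow> x i = y i) \<Longrightarrow> flip x j = flip y j"
  using psum_cong[of j x y] by (simp add: flip_def)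

lemma pmax_cong: "(\<And>i. i < n \<Longrightarrow> x i = y i) \<Longrightarrow> pmax x n = pmax y n"
proof (induction n)
  case (Suc n)
  then show ?case using psum_cong[of "Suc n" x y] by simp
qed simp

lemma psum_le_pmax: "k \<le> n \<Longrightarrow> psum x k \<le> pmax x n"
  by (induction n) (auto simp: le_Suc_eq le_max_iff_disj simp del: psum_Suc)

lemma pmax_attained: "\<exists>k\<le>n. pmax x n = psum x k"
proof (induction n)
  case (Suc n)
  then obtain k where "k \<le> n" "pmax x n = psum x k" by auto
  then show ?case
    by (cases "pmax x n \<le> psum x (Suc n)") (auto intro: exI[of _ k] exI[of _ "Suc n"] simp: max_def)
qed auto

text \<open>With X the position before the step and Y the position after it, the growth is |Y| - |X|
  - \<open>sg\<close> X * (Y - X) = |Y| - \<open>sg\<close> X * Y, which is nonnegative, and zero as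
  long as Y keeps the sign of X.\<close>

lemma walk_ltime_mono_Suc: "walk_ltime x n \<le> walk_ltime x (Suc n)"
  by (auto simp: walk_ltime_def flip_def sg_def)

lemma walk_ltime_mono: "k \<le> n \<Longrightarrow> walk_ltime x k \<le> walk_ltime x n"
  by (rule lift_Suc_mono_le[of "walk_ltime x"]) (rule walk_ltime_mono_Suc)

lemma walk_ltime_const: "0 \<le> sg (psum x n) * psum x (Suc n) \<Longrightarrow> walk_ltime x (Suc n) = walk_ltime x n"
  by (auto simp: walk_ltime_def flip_def sg_def split: if_splits)

text \<open>The flipped walk lies below \<open>walk_ltime x\<close> at every time, and a
  nondecreasing majorant also dominates the running maximum.\<close>

lemma pmax_flip_le_walk_ltime: "pmax (flip x) n \<le> walk_ltime x n"
proof -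
  obtain k where k: "k \<le> n" "pmax (flip x) n = psum (flip x) k"
    using pmax_attained by blast
  have "psum (flip x) k \<le> walk_ltime x k" by (simp add: walk_ltime_def)
  with k walk_ltime_mono[OF k(1), of x] show ?thesis by simp
qed

text \<open>Discrete Skorokhod lemma: \<open>walk_ltime x\<close> grows only when the walk changes sign, and then
  the walk is within one step of the origin.\<close>

lemma walk_ltime_le_pmax_flip:
  assumes "\<And>j. j < n \<Longrightarrow> \<bar>x j\<bar> \<le> r" "0 \<le> r"
  shows "walk_ltime x n \<le> pmax (flip x) n + r"
  using assms(1)
proof (induction n)
  case 0
  then show ?case using assms(2) by (simp add: walk_ltime_def)
next
  case (Suc n)
  show ?case
  proof (cases "0 \<le> sg (psum x n) * psum x (Suc n)")
    case True
    have "walk_ltime x n \<le> pmax (flip x) n + r" using Suc by simp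
    then show ?thesis unfolding walk_ltime_const[OF True] by simp
  next
    case False
    then have "\<bar>psum x (Suc n)\<bar> \<le> \<bar>x n\<bar>"
      by (auto simp: sg_def split: if_splits)
    also have "\<dots> \<le> r" using Suc.prems by simp
    finally have "\<bar>psum x (Suc n)\<bar> \<le> r" .
    moreover have "psum (flip x) (Suc n) \<le> pmax (flip x) (Suc n)"
      by (rule psum_le_pmax) simp
    ultimately show ?thesis by (simp add: walk_ltime_def del: psum_Suc)
  qed
qed

lemma abs_walk_ltime_pmax_flip_le:
  assumes "\<And>j. j < n \<Longrightarrow> \<bar>x j\<bar> \<le> r" "0 \<le> r"
  shows "\<bar>walk_ltime x n - pmax (flip x) n\<bar> \<le> r"
  using walk_ltime_le_pmax_flip[of n x r] pmax_flip_le_walk_ltime[of x n] assms by auto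

section \<open>Gaussian increments and the law of the walk\<close>

definition gauss :: "real \<Rightarrow> real measure" where
  "gauss d = density lborel (\<lambda>x. ennreal (normal_density 0 (sqrt d) x))"

lemma sets_gauss [measurable_cong, simp]: "sets (gauss d) = sets borel"
  and space_gauss [simp]: "space (gauss d) = UNIV"
  by (simp_all add: gauss_def)

lemma prob_space_gauss: "0 < d \<Longrightarrow> prob_space (gauss d)"
  unfolding gauss_def by (rule prob_space_normal_density) simp

lemma nn_integral_gauss_uminus:
  assumes [measurable]: "f \<in> borel_measurable borel" and "0 < d"
  shows "(\<integral>\<^sup>+y. f (- y) \<partial>gauss d) = (\<integral>\<^sup>+y. f y \<partial>gauss d)"
proof -
  have "(\<integral>\<^sup>+y. f y \<partial>gauss d)
      = (\<integral>\<^sup>+y. ennreal (normal_density 0 (sqrt d) y) * f y \<partial>lborel)"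
    unfolding gauss_def by (subst nn_integral_density) simp_all
  also have "\<dots> = (\<integral>\<^sup>+y. ennreal (normal_density 0 (sqrt d) (- y)) * f (- y) \<partial>lborel)"
    by (subst nn_integral_real_affine[where c="-1" and t=0]) simp_all
  also have "\<dots> = (\<integral>\<^sup>+y. ennreal (normal_density 0 (sqrt d) y) * f (- y) \<partial>lborel)"
    by (simp add: normal_density_def)
  also have "\<dots> = (\<integral>\<^sup>+y. f (- y) \<partial>gauss d)"
    unfolding gauss_def by (subst nn_integral_density) simp_all
  finally show ?thesis by simp
qed

text \<open>The moments needed later: the first two for the martingale sums with weights in front of
  the increments, the fourth for the variance of the squared increments, the third absolute one for
  the Taylor remainder.\<close>

lemma gauss_integral:
  fixes d :: real
  assumes d: "0 < d"
  shows gauss_moment_1: "has_bochner_integral (gauss d) (\<lambda>x. x) 0"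
    and gauss_moment_2: "has_bochner_integral (gauss d) (\<lambda>x. x\<^sup>2) d"
    and gauss_moment_4: "has_bochner_integral (gauss d) (\<lambda>x. x ^ 4) (3 * d\<^sup>2)"
    and gauss_abs_moment_3:
      "has_bochner_integral (gauss d) (\<lambda>x. \<bar>x\<bar> ^ 3) (2 * sqrt d ^ 3 * sqrt (2 / pi))"
proof -
  have s: "0 < sqrt d" using d by simp
  have *: "has_bochner_integral (gauss d) g v"
    if "has_bochner_integral lborel (\<lambda>x. normal_density 0 (sqrt d) x * g x) v"
       "g \<in> borel_measurable borel" for g and v :: real
    unfolding gauss_def using that by (intro has_bochner_integral_density) auto
  show "has_bochner_integral (gauss d) (\<lambda>x. x) 0"
    by (rule *) (use normal_moment_odd[OF s, of 0 0] in simp_all)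
  show "has_bochner_integral (gauss d) (\<lambda>x. x\<^sup>2) d"
    by (rule *) (use normal_moment_even[OF s, of 0 1] d in \<open>simp_all add: fact_numeral\<close>)
  show "has_bochner_integral (gauss d) (\<lambda>x. x ^ 4) (3 * d\<^sup>2)"
    by (rule *) (use normal_moment_even[OF s, of 0 2] d in \<open>simp_all add: fact_numeral power2_eq_square\<close>)
  show "has_bochner_integral (gauss d) (\<lambda>x. \<bar>x\<bar> ^ 3) (2 * sqrt d ^ 3 * sqrt (2 / pi))"
    by (rule *) (use normal_moment_abs_odd[OF s, of 0 1] in \<open>simp_all add: numeral_3_eq_3\<close>)
qed

definition walk :: "nat \<Rightarrow> real \<Rightarrow> (nat \<Rightarrow> real) measure" where
  "walk n d = PiM {..<n} (\<lambda>_. gauss d)"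

lemma sets_walk [measurable_cong]: "sets (walk n d) = sets (PiM {..<n} (\<lambda>_. borel))"
  unfolding walk_def by (rule sets_PiM_cong) simp_all

text \<open>Fubini for the last increment, which is how conditioning on the past is expressed in the
  inductions below.\<close>

lemma nn_integral_walk_Suc:
  assumes "f \<in> borel_measurable (PiM {..<Suc n} (\<lambda>_. borel))" and d: "0 < d"
  shows "(\<integral>\<^sup>+x. f x \<partial>walk (Suc n) d) = (\<integral>\<^sup>+x. (\<integral>\<^sup>+y. f (x(n := y)) \<partial>gauss d) \<partial>walk n d)"
proof -
  interpret g: prob_space "gauss d" by (rule prob_space_gauss[OF d])
  interpret product_sigma_finite "\<lambda>_::nat. gauss d" ..
  have "sets (PiM (insert n {..<n}) (\<lambda>_. gauss d)) = sets (PiM {..<Suc n} (\<lambda>_. borel))"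
    by (rule sets_PiM_cong) (auto simp: lessThan_Suc)
  then have "f \<in> borel_measurable (PiM (insert n {..<n}) (\<lambda>_. gauss d))"
    using assms(1) by (simp cong: measurable_cong_sets)
  then show ?thesis
    unfolding walk_def lessThan_Suc by (subst product_nn_integral_insert) auto
qed

lemma measurable_psum [measurable]:
  "k \<le> n \<Longrightarrow> (\<lambda>x. psum x k) \<in> borel_measurable (PiM {..<n} (\<lambda>_. borel))"
  unfolding psum_def by (intro borel_measurable_sum measurable_component_singleton) auto

lemma measurable_sg [measurable]: "sg \<in> borel_measurable borel"
  unfolding sg_def by measurable

lemma measurable_flip [measurable]:
  "k < n \<Longrightarrow> (\<lambda>x. flip x k) \<in> borel_measurable (PiM {..<n} (\<lambda>_. borel))"
proof -
  assume k: "k < n"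
  then have [measurable]: "(\<lambda>x. x k) \<in> borel_measurable (PiM {..<n} (\<lambda>_. borel :: real measure))"
    by (intro measurable_component_singleton) auto
  have [measurable]: "(\<lambda>x. psum x k) \<in> borel_measurable (PiM {..<n} (\<lambda>_. borel))"
    using k by (intro measurable_psum) auto
  show ?thesis unfolding flip_def by measurable
qed

lemma measurable_flip_vec [measurable]:
  "(\<lambda>x. \<lambda>j\<in>{..<n}. flip x j) \<in> measurable (PiM {..<n} (\<lambda>_. borel)) (PiM {..<n} (\<lambda>_. borel))"
  by (intro measurable_restrict measurable_flip) auto

text \<open>Given the first n increments, the last one is multiplied by a fixed sign, which its
  symmetric law does not notice. What is left is a function of the first n flipped increments, to
  which the induction hypothesis applies; hence the induction runs over all \<open>f\<close> at
  once.\<close>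

lemma nn_integral_walk_flip:
  assumes d: "0 < d"
    and f: "f \<in> borel_measurable (PiM {..<n} (\<lambda>_. borel))"
  shows "(\<integral>\<^sup>+x. f (\<lambda>j\<in>{..<n}. flip x j) \<partial>walk n d) = (\<integral>\<^sup>+x. f x \<partial>walk n d)"
  using f
proof (induction n arbitrary: f)
  case 0
  then show ?case
    unfolding walk_def by (intro nn_integral_cong) (auto simp: space_PiM PiE_empty_domain fun_eq_iff)
next
  case (Suc n)
  note f [measurable] = Suc.prems
  have upd [measurable]: "(\<lambda>(x, y). x(n := y)) \<in> measurable (PiM {..<n} (\<lambda>_. borel) \<Otimes>\<^sub>M borel)
      (PiM {..<Suc n} (\<lambda>_. borel :: real measure))"
    using measurable_add_dim[of n "{..<n}" "\<lambda>_. borel :: real measure"] by (simp add: lessThan_Suc)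
  interpret g: prob_space "gauss d" by (rule prob_space_gauss[OF d])
  have fm [measurable]: "(\<lambda>y. f (x(n := y))) \<in> borel_measurable borel"
    if "x \<in> space (PiM {..<n} (\<lambda>_. borel :: real measure))" for x
  proof -
    have "(\<lambda>y. (\<lambda>(x, y). x(n := y)) (x, y)) \<in> measurable borel (PiM {..<Suc n} (\<lambda>_. borel :: real measure))"
      using that by (intro measurable_compose[OF _ upd] measurable_Pair) auto
    then show ?thesis using f by simp
  qed
  \<comment> \<open>No flipped increment before index n sees the new coordinate, and the sign at
    index n depends on the partial sum of the old ones.\<close>
  have fl: "(\<lambda>j\<in>{..<Suc n}. flip (x(n := y)) j)
      = (\<lambda>j\<in>{..<n}. flip x j)(n := - sg (psum x n) * y)" for x y
  proof
    fix j
    have "psum (x(n := y)) n = psum x n" by (rule psum_cong) simp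
    moreover have "flip (x(n := y)) j = flip x j" if "j < n"
      using that by (intro flip_cong) auto
    ultimately show "(\<lambda>j\<in>{..<Suc n}. flip (x(n := y)) j) j
      = ((\<lambda>j\<in>{..<n}. flip x j)(n := - sg (psum x n) * y)) j"
      by (auto simp: flip_def less_Suc_eq)
  qed
  have "(\<integral>\<^sup>+x. f (\<lambda>j\<in>{..<Suc n}. flip x j) \<partial>walk (Suc n) d)
      = (\<integral>\<^sup>+x. (\<integral>\<^sup>+y. f ((\<lambda>j\<in>{..<n}. flip x j)(n := - sg (psum x n) * y)) \<partial>gauss d) \<partial>walk n d)"
    by (subst nn_integral_walk_Suc[OF _ d]) (simp_all add: fl)
  also have "\<dots> = (\<integral>\<^sup>+x. (\<integral>\<^sup>+y. f ((\<lambda>j\<in>{..<n}. flip x j)(n := y)) \<partial>gauss d) \<partial>walk n d)"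
  proof (rule nn_integral_cong)
    fix x assume x: "x \<in> space (walk n d)"
    let ?x = "\<lambda>j\<in>{..<n}. flip x j"
    have "?x \<in> space (PiM {..<n} (\<lambda>_. borel))" by (simp add: space_PiM)
    from nn_integral_gauss_uminus[OF fm[OF this] d]
    show "(\<integral>\<^sup>+y. f (?x(n := - sg (psum x n) * y)) \<partial>gauss d) = (\<integral>\<^sup>+y. f (?x(n := y)) \<partial>gauss d)"
      by (simp add: sg_def)
  qed
  also have "\<dots> = (\<integral>\<^sup>+x. (\<integral>\<^sup>+y. f (x(n := y)) \<partial>gauss d) \<partial>walk n d)"
  proof (rule Suc.IH)
    have "(\<lambda>(x, y). f (x(n := y))) \<in> borel_measurable (PiM {..<n} (\<lambda>_. borel) \<Otimes>\<^sub>M borel)"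
      using measurable_compose[OF upd f] by (simp add: case_prod_beta)
    then have "(\<lambda>(x, y). f (x(n := y))) \<in> borel_measurable (PiM {..<n} (\<lambda>_. borel) \<Otimes>\<^sub>M gauss d)"
      by simp
    then show "(\<lambda>x. \<integral>\<^sup>+y. f (x(n := y)) \<partial>gauss d) \<in> borel_measurable (PiM {..<n} (\<lambda>_. borel))"
      by (rule g.borel_measurable_nn_integral)
  qed
  also have "\<dots> = (\<integral>\<^sup>+x. f x \<partial>walk (Suc n) d)"
    by (subst nn_integral_walk_Suc[OF f d]) simp
  finally show ?case .
qed

lemma measurable_walk_component:
  "k < n \<Longrightarrow> (\<lambda>x. x k) \<in> borel_measurable (PiM {..<n} (\<lambda>_. borel :: real measure))"
  by (intro measurable_component_singleton) auto

lemma measurable_walk_sum: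
  assumes [measurable]: "c \<in> borel_measurable borel" "u \<in> borel_measurable borel" and "m \<le> n"
  shows "(\<lambda>x. \<Sum>j<m. c (psum x j) * u (x j) :: real) \<in> borel_measurable (PiM {..<n} (\<lambda>_. borel))"
proof (intro borel_measurable_sum borel_measurable_times)
  fix j assume "j \<in> {..<m}"
  then have j: "j < n" using assms by auto
  show "(\<lambda>x. c (psum x j)) \<in> borel_measurable (PiM {..<n} (\<lambda>_. borel))"
    using j by (intro measurable_compose[OF measurable_psum]) auto
  show "(\<lambda>x. u (x j)) \<in> borel_measurable (PiM {..<n} (\<lambda>_. borel))"
    using j by (intro measurable_compose[OF measurable_walk_component]) auto
qed

text \<open>Martingale differences are orthogonal, so only the diagonal terms survive.\<close>

lemma nn_integral_walk_square:
  fixes c u :: "real \<Rightarrow> real"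
  assumes d: "0 < d"
    and [measurable]: "c \<in> borel_measurable borel" "u \<in> borel_measurable borel"
    and u1: "has_bochner_integral (gauss d) u 0"
    and u2: "has_bochner_integral (gauss d) (\<lambda>y. (u y)\<^sup>2) v"
  shows "(\<integral>\<^sup>+x. ennreal ((\<Sum>j<n. c (psum x j) * u (x j))\<^sup>2) \<partial>walk n d)
    = (\<integral>\<^sup>+x. ennreal (\<Sum>j<n. v * (c (psum x j))\<^sup>2) \<partial>walk n d)"
proof (induction n)
  case 0
  show ?case by simp
next
  case (Suc n)
  interpret g: prob_space "gauss d" by (rule prob_space_gauss[OF d])
  have v: "0 \<le> v" using u2 by (metis Bochner_Integration.integral_nonneg has_bochner_integral_integral_eq zero_le_power2)
  have m1: "(\<lambda>x. ennreal ((\<Sum>j<m. c (psum x j) * u (x j))\<^sup>2)) \<in> borel_measurable (PiM {..<m} (\<lambda>_. borel))" for m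
    by (intro measurable_compose[OF measurable_walk_sum[OF assms(2,3), of m m]]) auto
  have m2: "(\<lambda>x. ennreal (\<Sum>j<m. v * (c (psum x j))\<^sup>2)) \<in> borel_measurable (PiM {..<m} (\<lambda>_. borel))" for m
    using measurable_walk_sum[of "\<lambda>z. v * (c z)\<^sup>2" "\<lambda>_. 1" m m] by simp
  have m3: "(\<lambda>x. ennreal (v * (c (psum x n))\<^sup>2)) \<in> borel_measurable (PiM {..<n} (\<lambda>_. borel))"
    by (intro measurable_compose[OF measurable_psum, of n n "\<lambda>z. ennreal (v * (c z)\<^sup>2)"]) auto
  note m = m1 m2 m3
  have w: "borel_measurable (walk n d) = borel_measurable (PiM {..<n} (\<lambda>_. borel))" for n
    by (rule measurable_cong_sets) (simp_all add: sets_walk)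
  have S: "(\<Sum>j<Suc n. c (psum (x(n := y)) j) * u ((x(n := y)) j))
      = (\<Sum>j<n. c (psum x j) * u (x j)) + c (psum x n) * u y"
    "(\<Sum>j<Suc n. v * (c (psum (x(n := y)) j))\<^sup>2) = (\<Sum>j<n. v * (c (psum x j))\<^sup>2) + v * (c (psum x n))\<^sup>2"
    for x and y :: real
  proof -
    have "psum (x(n := y)) j = psum x j" if "j \<le> n" for j
      using that by (intro psum_cong) auto
    then show "(\<Sum>j<Suc n. c (psum (x(n := y)) j) * u ((x(n := y)) j))
      = (\<Sum>j<n. c (psum x j) * u (x j)) + c (psum x n) * u y"
    "(\<Sum>j<Suc n. v * (c (psum (x(n := y)) j))\<^sup>2) = (\<Sum>j<n. v * (c (psum x j))\<^sup>2) + v * (c (psum x n))\<^sup>2"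
      by (auto intro!: sum.cong)
  qed
  \<comment> \<open>Here a stands for the sum over the past and b for the weight of the new term;
    the cross term drops out because \<open>u\<close> has mean zero.\<close>
  have inner: "(\<integral>\<^sup>+y. ennreal ((a + b * u y)\<^sup>2) \<partial>gauss d) = ennreal (a\<^sup>2) + ennreal (v * b\<^sup>2)" for a b
  proof -
    have "has_bochner_integral (gauss d) (\<lambda>y. a\<^sup>2 + 2 * a * b * u y + b\<^sup>2 * (u y)\<^sup>2)
        (a\<^sup>2 + 2 * a * b * 0 + b\<^sup>2 * v)"
      by (intro has_bochner_integral_add has_bochner_integral_mult_right u1 u2)
         (auto simp: has_bochner_integral_iff g.prob_space[simplified])
    then have "has_bochner_integral (gauss d) (\<lambda>y. (a + b * u y)\<^sup>2) (a\<^sup>2 + v * b\<^sup>2)"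
      by (simp add: power2_sum power_mult_distrib algebra_simps)
    then have "(\<integral>\<^sup>+y. ennreal ((a + b * u y)\<^sup>2) \<partial>gauss d) = ennreal (a\<^sup>2 + v * b\<^sup>2)"
      by (subst nn_integral_eq_integral) (auto simp: has_bochner_integral_iff)
    then show ?thesis using v by (simp add: ennreal_plus)
  qed
  have "(\<integral>\<^sup>+x. ennreal ((\<Sum>j<Suc n. c (psum x j) * u (x j))\<^sup>2) \<partial>walk (Suc n) d)
     = (\<integral>\<^sup>+x. ennreal ((\<Sum>j<n. c (psum x j) * u (x j))\<^sup>2) + ennreal (v * (c (psum x n))\<^sup>2) \<partial>walk n d)"
    by (subst nn_integral_walk_Suc[OF m1 d]) (simp only: S inner)
  also have "\<dots> = (\<integral>\<^sup>+x. ennreal (\<Sum>j<n. v * (c (psum x j))\<^sup>2) \<partial>walk n d)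
     + (\<integral>\<^sup>+x. ennreal (v * (c (psum x n))\<^sup>2) \<partial>walk n d)"
    unfolding Suc.IH[symmetric] by (rule nn_integral_add; simp only: w m)
  also have "\<dots> = (\<integral>\<^sup>+x. ennreal (\<Sum>j<n. v * (c (psum x j))\<^sup>2) + ennreal (v * (c (psum x n))\<^sup>2) \<partial>walk n d)"
    by (rule nn_integral_add[symmetric]; simp only: w m)
  also have "\<dots> = (\<integral>\<^sup>+x. ennreal ((\<Sum>j<n. v * (c (psum x j))\<^sup>2) + v * (c (psum x n))\<^sup>2) \<partial>walk n d)"
    using v by (intro nn_integral_cong ennreal_plus[symmetric] sum_nonneg) auto
  also have "\<dots> = (\<integral>\<^sup>+x. ennreal (\<Sum>j<Suc n. v * (c (psum x j))\<^sup>2) \<partial>walk (Suc n) d)"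
    by (subst nn_integral_walk_Suc[OF m2 d]) (simp add: S g.emeasure_space_1[simplified] del: sum.lessThan_Suc)
  finally show ?case .
qed

section \<open>Discretization of continuous paths\<close>

text \<open>Besides being the mesh of the time grid, this serves as the sequence of smoothing widths
  e tending to 0. The two uses have separate indices.\<close>

definition step :: "nat \<Rightarrow> real" where
  "step m = 1 / real (Suc m)"

definition cnt :: "nat \<Rightarrow> real \<Rightarrow> nat" where
  "cnt m t = nat \<lfloor>t * real (Suc m)\<rfloor>"

definition incr :: "nat \<Rightarrow> (real \<Rightarrow> real) \<Rightarrow> nat \<Rightarrow> real" where
  "incr m w j = w (real (Suc j) * step m) - w (real j * step m)"

lemma step_pos [simp]: "0 < step m" "0 \<le> step m"
  by (simp_all add: step_def)

lemma step_tendsto_0: "step \<longlonglongrightarrow> 0"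
  unfolding step_def using LIMSEQ_inverse_real_of_nat by (simp add: inverse_eq_divide)

lemma cnt_le: "0 \<le> t \<Longrightarrow> real (cnt m t) * step m \<le> t"
proof -
  assume t: "0 \<le> t"
  then have "real (cnt m t) = of_int \<lfloor>t * real (Suc m)\<rfloor>"
    unfolding cnt_def by (intro of_nat_nat) simp
  also have "\<dots> \<le> t * real (Suc m)" by (rule of_int_floor_le)
  finally show ?thesis by (simp add: step_def field_simps)
qed

lemma cnt_greater: "t < real (cnt m t) * step m + step m"
proof -
  have "t * real (Suc m) < of_int \<lfloor>t * real (Suc m)\<rfloor> + 1"
    by (rule floor_correct[THEN conjunct2, unfolded of_int_add of_int_1])
  also have "\<dots> \<le> real (cnt m t) + 1"
    unfolding cnt_def by (simp add: real_of_int_floor_add_one_gt)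
  finally show ?thesis by (simp add: step_def field_simps)
qed

lemma cnt_mono: "s \<le> t \<Longrightarrow> cnt m s \<le> cnt m t"
  unfolding cnt_def by (intro nat_mono floor_mono mult_right_mono) auto

lemma grid_le: "0 \<le> t \<Longrightarrow> j \<le> cnt m t \<Longrightarrow> real j * step m \<le> t"
  using order_trans[OF mult_right_mono[of "real j" "real (cnt m t)" "step m"] cnt_le[of t m]] by simp

lemma grid_tendsto:
  assumes "0 \<le> t"
  shows "(\<lambda>m. real (cnt m t) * step m) \<longlonglongrightarrow> t"
proof (rule real_tendsto_sandwich[where f="\<lambda>m. t - step m" and h="\<lambda>_. t"])
  show "\<forall>\<^sub>F m in sequentially. t - step m \<le> real (cnt m t) * step m"
    using cnt_greater[of t] by (auto intro!: always_eventually simp: less_imp_le algebra_simps)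
  show "\<forall>\<^sub>F m in sequentially. real (cnt m t) * step m \<le> t"
    using cnt_le[OF assms] by simp
  show "(\<lambda>m. t - step m) \<longlonglongrightarrow> t"
    using tendsto_diff[OF tendsto_const[of t] step_tendsto_0] by simp
qed simp

lemma grid_value_tendsto:
  assumes "continuous_on {0..} w" "0 \<le> t"
  shows "(\<lambda>m. w (real (cnt m t) * step m)) \<longlonglongrightarrow> w t"
  using continuous_on_tendsto_compose[OF assms(1) grid_tendsto[OF assms(2)]] assms(2) by simp

lemma psum_incr: "psum (incr m w) n = w (real n * step m) - w 0"
  by (induction n) (simp_all add: incr_def)

lemma uniform_grid:
  fixes w :: "real \<Rightarrow> real"
  assumes w: "continuous_on {0..} w" and e: "0 < e"
  shows "\<forall>\<^sub>F m in sequentially. \<forall>s\<in>{0..t}. \<forall>r\<in>{0..t}. \<bar>s - r\<bar> \<le> step m \<longrightarrow> \<bar>w s - w r\<bar> \<le> e"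
proof -
  have "uniformly_continuous_on {0..t} w"
    by (intro compact_uniformly_continuous continuous_on_subset[OF w]) auto
  then obtain d where d: "0 < d" "\<And>s r. s \<in> {0..t} \<Longrightarrow> r \<in> {0..t} \<Longrightarrow> dist r s < d \<Longrightarrow> dist (w r) (w s) < e"
    unfolding uniformly_continuous_on_def using e by metis
  have "\<forall>\<^sub>F m in sequentially. step m < d"
    using step_tendsto_0 d(1) by (rule order_tendstoD)
  then show ?thesis
  proof eventually_elim
    case (elim m)
    show ?case
    proof (intro ballI impI)
      fix s r assume "s \<in> {0..t}" "r \<in> {0..t}" "\<bar>s - r\<bar> \<le> step m"
      then show "\<bar>w s - w r\<bar> \<le> e"
        using d(2)[of r s] elim by (auto simp: dist_real_def less_imp_le)
    qed
  qed
qed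

lemma incr_small:
  fixes w :: "real \<Rightarrow> real"
  assumes "continuous_on {0..} w" "0 < e" "0 \<le> t"
  shows "\<forall>\<^sub>F m in sequentially. \<forall>j<cnt m t. \<bar>incr m w j\<bar> \<le> e"
  using uniform_grid[OF assms(1,2), of t]
proof eventually_elim
  case (elim m)
  show ?case
  proof (intro allI impI)
    fix j assume "j < cnt m t"
    then have "real (Suc j) * step m \<le> t" "real j * step m \<le> t"
      using assms(3) by (auto intro!: grid_le simp del: of_nat_Suc)
    then show "\<bar>incr m w j\<bar> \<le> e"
      using elim[rule_format, of "real (Suc j) * step m" "real j * step m"]
      by (simp add: incr_def algebra_simps)
  qed
qed

text \<open>The supremum is attained at some s. The grid point just below s bounds the discrete
  maximum from below, and all grid points that enter it lie in [0, t], which bounds it from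
  above.\<close>

lemma pmax_incr_tendsto:
  fixes w :: "real \<Rightarrow> real"
  assumes w: "continuous_on {0..} w" and w0: "w 0 = 0" and t: "0 \<le> t"
  shows "(\<lambda>m. pmax (incr m w) (cnt m t)) \<longlonglongrightarrow> (SUP s\<in>{0..t}. w s)"
proof -
  have "compact (w ` {0..t})"
    by (intro compact_continuous_image continuous_on_subset[OF w]) auto
  then have bdd: "bdd_above (w ` {0..t})"
    by (intro bounded_imp_bdd_above compact_imp_bounded)
  obtain s where s: "s \<in> {0..t}" "\<And>r. r \<in> {0..t} \<Longrightarrow> w r \<le> w s"
    using continuous_attains_sup[of "{0..t}" w] t continuous_on_subset[OF w, of "{0..t}"] by auto
  have S: "(SUP s\<in>{0..t}. w s) = w s"
    using s bdd t by (intro antisym cSUP_least cSUP_upper) auto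
  show ?thesis
    unfolding S
  proof (rule real_tendsto_sandwich[where f="\<lambda>m. w (real (cnt m s) * step m)" and h="\<lambda>_. w s"])
    show "\<forall>\<^sub>F m in sequentially. w (real (cnt m s) * step m) \<le> pmax (incr m w) (cnt m t)"
    proof (rule always_eventually, rule allI)
      fix m
      have "psum (incr m w) (cnt m s) \<le> pmax (incr m w) (cnt m t)"
        using s by (intro psum_le_pmax cnt_mono) auto
      then show "w (real (cnt m s) * step m) \<le> pmax (incr m w) (cnt m t)"
        by (simp add: psum_incr w0)
    qed
    show "\<forall>\<^sub>F m in sequentially. pmax (incr m w) (cnt m t) \<le> w s"
    proof (rule always_eventually, rule allI)
      fix m
      obtain k where k: "k \<le> cnt m t" "pmax (incr m w) (cnt m t) = psum (incr m w) k"
        using pmax_attained by blast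
      with grid_le[OF t k(1)] s(2)[of "real k * step m"]
      show "pmax (incr m w) (cnt m t) \<le> w s" by (simp add: psum_incr w0)
    qed
    show "(\<lambda>m. w (real (cnt m s) * step m)) \<longlonglongrightarrow> w s"
      using s by (intro grid_value_tendsto[OF w]) auto
  qed simp
qed

text \<open>The grid need not end at t. The sum is first compared with the integral over the
  complete cells, where uniform continuity bounds the error cell by cell; the integral over the
  incomplete last cell vanishes by continuity of the indefinite integral.\<close>

lemma riemann_tendsto:
  fixes w :: "real \<Rightarrow> real"
  assumes w: "continuous_on {0..} w" and t: "0 \<le> t"
  shows "(\<lambda>m. \<Sum>j<cnt m t. w (real j * step m) * step m) \<longlonglongrightarrow> integral {0..t} w"
proof -
  have wi: "w integrable_on {a..b}" if "0 \<le> a" for a b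
    using that by (intro integrable_continuous_real continuous_on_subset[OF w]) auto
  let ?I = "\<lambda>m. integral {0..real (cnt m t) * step m} w"
  let ?R = "\<lambda>m n. \<Sum>j<n. w (real j * step m) * step m"
  have I: "?I \<longlonglongrightarrow> integral {0..t} w"
  proof -
    have "continuous_on {0..t} (\<lambda>x. integral {0..x} w)"
      by (intro indefinite_integral_continuous_1 wi) simp
    then show ?thesis
      using cnt_le[OF t] t by (intro continuous_on_tendsto_compose[OF _ grid_tendsto[OF t]]) auto
  qed
  have "(\<lambda>m. ?R m (cnt m t) - ?I m) \<longlonglongrightarrow> 0"
  proof (rule tendstoI)
    fix e :: real assume e: "0 < e"
    \<comment> \<open>The error over all cells is at most \<eta> * t, which is below e also for t =
      0.\<close>
    define \<eta> where "\<eta> = e / (t + 1)"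
    have \<eta>: "0 < \<eta>" using e t by (simp add: \<eta>_def)
    show "\<forall>\<^sub>F m in sequentially. dist (?R m (cnt m t) - ?I m) 0 < e"
      using uniform_grid[OF w \<eta>, of t]
    proof eventually_elim
      case (elim m)
      have "n \<le> cnt m t \<Longrightarrow> \<bar>?R m n - integral {0..real n * step m} w\<bar> \<le> \<eta> * (real n * step m)" for n
      proof (induction n)
        case (Suc n)
        let ?a = "real n * step m" and ?b = "real (Suc n) * step m"
        have ab: "0 \<le> ?a" "?a \<le> ?b" "?b - ?a = step m" by (simp_all add: algebra_simps)
        have bt: "?b \<le> t" using Suc.prems t by (intro grid_le)
        have comb: "integral {0..?b} w = integral {0..?a} w + integral {?a..?b} w"
          using ab by (intro Henstock_Kurzweil_Integration.integral_combine[symmetric] wi) auto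
        have "\<bar>integral {?a..?b} w - w ?a * step m\<bar> \<le> \<eta> * step m"
        proof -
          have "((\<lambda>s. w s - w ?a) has_integral (integral {?a..?b} w - w ?a * step m)) {?a..?b}"
            using has_integral_diff[OF integrable_integral[OF wi[OF ab(1)]] has_integral_const_real[of "w ?a" ?a ?b]] ab
            by (simp add: mult.commute del: of_nat_Suc)
          moreover have "norm (w s - w ?a) \<le> \<eta>" if "s \<in> {?a..?b} - {}" for s
          proof -
            from that ab have "0 \<le> s" "s \<le> ?b" "\<bar>s - ?a\<bar> \<le> step m"
              unfolding Diff_empty atLeastAtMost_iff by linarith+
            with elim[rule_format, of s ?a] ab bt show ?thesis by simp
          qed
          ultimately have "norm (integral {?a..?b} w - w ?a * step m) \<le> \<eta> * measure lborel {?a..?b}"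
            using \<eta> by (intro has_integral_bound_real[where S="{}"]) auto
          with ab show ?thesis by (simp del: of_nat_Suc)
        qed
        moreover have "\<bar>?R m n - integral {0..?a} w\<bar> \<le> \<eta> * ?a" using Suc by simp
        moreover have "\<eta> * ?b = \<eta> * ?a + \<eta> * step m" by (simp add: algebra_simps)
        ultimately show ?case unfolding comb by (simp del: of_nat_Suc)
      qed simp
      from this[of "cnt m t"]
      have "\<bar>?R m (cnt m t) - ?I m\<bar> \<le> \<eta> * (real (cnt m t) * step m)" by simp
      also have "\<dots> \<le> \<eta> * t" using \<eta> cnt_le[OF t] by (intro mult_left_mono) auto
      also have "\<dots> < e" using e t by (simp add: \<eta>_def field_simps)
      finally show ?case by simp
    qed
  qed
  from tendsto_add[OF this I] show ?thesis by simp
qed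

section \<open>Smooth approximation of the absolute value\<close>

definition smooth_abs :: "real \<Rightarrow> real \<Rightarrow> real" where
  "smooth_abs e x = sqrt (x\<^sup>2 + e\<^sup>2)"

definition smooth_sg :: "real \<Rightarrow> real \<Rightarrow> real" where
  "smooth_sg e x = x / smooth_abs e x"

text \<open>The second derivative of \<open>smooth_abs e\<close>. Its total mass is 2, since its
  primitive \<open>smooth_sg e\<close> climbs from -1 to 1.\<close>

definition bump :: "real \<Rightarrow> real \<Rightarrow> real" where
  "bump e x = e\<^sup>2 / smooth_abs e x ^ 3"

lemma smooth_abs_ge: "0 < e \<Longrightarrow> e \<le> smooth_abs e x" "\<bar>x\<bar> \<le> smooth_abs e x"
  unfolding smooth_abs_def by (intro real_le_rsqrt; simp)+

lemma smooth_abs_pos: "0 < e \<Longrightarrow> 0 < smooth_abs e x"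
  using smooth_abs_ge(1)[of e x] by linarith

lemma smooth_abs_sq: "(smooth_abs e x)\<^sup>2 = x\<^sup>2 + e\<^sup>2"
  unfolding smooth_abs_def by simp

lemma smooth_abs_le: "0 < e \<Longrightarrow> smooth_abs e x \<le> \<bar>x\<bar> + e"
  unfolding smooth_abs_def using sqrt_sum_squares_le_sum_abs[of x e] by simp

lemma smooth_abs_lipschitz: "0 < e \<Longrightarrow> \<bar>smooth_abs e x - smooth_abs e y\<bar> \<le> \<bar>x - y\<bar>"
proof -
  assume e: "0 < e"
  let ?a = "smooth_abs e x" and ?b = "smooth_abs e y"
  have "(?a - ?b) * (?a + ?b) = (x - y) * (x + y)"
    using smooth_abs_sq[of e x] smooth_abs_sq[of e y] by (simp add: power2_eq_square algebra_simps)
  then have "\<bar>?a - ?b\<bar> * (?a + ?b) = \<bar>x - y\<bar> * \<bar>x + y\<bar>"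
    using smooth_abs_pos[OF e, of x] smooth_abs_pos[OF e, of y] by (metis abs_mult abs_of_pos add_pos_pos)
  also have "\<dots> \<le> \<bar>x - y\<bar> * (?a + ?b)"
    using smooth_abs_ge(2)[of x e] smooth_abs_ge(2)[of y e] by (intro mult_left_mono) auto
  finally show ?thesis
    using smooth_abs_pos[OF e, of x] smooth_abs_pos[OF e, of y] by (auto simp: mult_le_cancel_right)
qed

lemma DERIV_smooth_abs:
  assumes e: "0 < e" shows "(smooth_abs e has_real_derivative smooth_sg e x) (at x)"
proof -
  have "0 < x\<^sup>2 + e\<^sup>2" using e by (simp add: add_nonneg_pos)
  then show ?thesis
    unfolding smooth_abs_def smooth_sg_def
    by (auto intro!: derivative_eq_intros simp: field_simps)
qed

lemma DERIV_smooth_sg: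
  assumes e: "0 < e" shows "(smooth_sg e has_real_derivative bump e x) (at x)"
proof -
  let ?a = "smooth_abs e x"
  have a: "0 < ?a" by (rule smooth_abs_pos[OF e])
  have "(smooth_sg e has_real_derivative ((1 * ?a - x * smooth_sg e x) / (?a * ?a))) (at x)"
    unfolding smooth_sg_def[abs_def]
    using a by (intro DERIV_divide DERIV_ident DERIV_smooth_abs[OF e, unfolded smooth_sg_def]) auto
  also have "(1 * ?a - x * smooth_sg e x) / (?a * ?a) = (?a\<^sup>2 - x\<^sup>2) / ?a ^ 3"
    using a unfolding smooth_sg_def by (simp add: field_simps power2_eq_square power3_eq_cube)
  finally show ?thesis unfolding smooth_abs_sq bump_def by simp
qed

lemma bump_nonneg: "0 < e \<Longrightarrow> 0 \<le> bump e x"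
  unfolding bump_def using smooth_abs_pos[of e x] by simp

lemma bump_le: "0 < e \<Longrightarrow> bump e x \<le> 1 / e"
proof -
  assume e: "0 < e"
  have "e ^ 3 \<le> smooth_abs e x ^ 3" using smooth_abs_ge(1)[OF e] e by (intro power_mono) auto
  then have "bump e x \<le> e\<^sup>2 / e ^ 3" unfolding bump_def using e smooth_abs_pos[OF e] by (intro divide_left_mono) auto
  also have "\<dots> = 1 / e" using e by (simp add: power2_eq_square power3_eq_cube)
  finally show ?thesis .
qed

lemma isCont_bump: "0 < e \<Longrightarrow> isCont (bump e) x"
proof -
  assume e: "0 < e"
  have "0 < x\<^sup>2 + e\<^sup>2" using e by (simp add: add_nonneg_pos)
  then show ?thesis
    unfolding bump_def smooth_abs_def by (auto intro!: continuous_intros)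
qed

text \<open>Factor the difference of the cubes of 1/a and 1/b, where a and b are the values of
  \<open>smooth_abs e\<close>. The three products of inverses are at most 1/e^2 each, and 1/a - 1/b
  is at most |x - y| / e^2 because \<open>smooth_abs e\<close> is 1-Lipschitz.\<close>

lemma bump_lipschitz: "0 < e \<Longrightarrow> \<bar>bump e x - bump e y\<bar> \<le> 3 / e\<^sup>2 * \<bar>x - y\<bar>"
proof -
  assume e: "0 < e"
  let ?a = "smooth_abs e x" and ?b = "smooth_abs e y"
  have ab: "e \<le> ?a" "e \<le> ?b" "0 < ?a" "0 < ?b"
    using smooth_abs_ge(1)[OF e] smooth_abs_pos[OF e] by auto
  have inv: "1 / ?a \<le> 1 / e" "1 / ?b \<le> 1 / e" using ab e by (auto intro!: divide_left_mono)
  have sq: "1 / ?a * (1 / ?b) \<le> 1 / e * (1 / e)" "(1 / ?a) * (1 / ?a) \<le> 1 / e * (1 / e)" "(1 / ?b) * (1 / ?b) \<le> 1 / e * (1 / e)"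
    using ab e inv by (intro mult_mono; simp)+
  have d: "\<bar>1 / ?a - 1 / ?b\<bar> \<le> 1 / e * (1 / e) * \<bar>x - y\<bar>"
  proof -
    have "1 / ?a - 1 / ?b = (1 / ?a * (1 / ?b)) * (?b - ?a)" using ab by (simp add: field_simps)
    then have "\<bar>1 / ?a - 1 / ?b\<bar> = (1 / ?a * (1 / ?b)) * \<bar>?b - ?a\<bar>" using ab by (simp add: abs_mult)
    also have "\<dots> \<le> (1 / e * (1 / e)) * \<bar>x - y\<bar>"
      using smooth_abs_lipschitz[OF e, of y x] e by (intro mult_mono[OF sq(1)]) (auto simp: abs_minus_commute)
    finally show ?thesis .
  qed
  have "bump e x - bump e y
      = e\<^sup>2 * ((1 / ?a - 1 / ?b) * ((1 / ?a) * (1 / ?a) + 1 / ?a * (1 / ?b) + (1 / ?b) * (1 / ?b)))"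
    unfolding bump_def by (simp add: algebra_simps power3_eq_cube)
  then have "\<bar>bump e x - bump e y\<bar>
      = e\<^sup>2 * (\<bar>1 / ?a - 1 / ?b\<bar> * ((1 / ?a) * (1 / ?a) + 1 / ?a * (1 / ?b) + (1 / ?b) * (1 / ?b)))"
    using ab by (simp add: abs_mult)
  also have "\<dots> \<le> e\<^sup>2 * ((1 / e * (1 / e) * \<bar>x - y\<bar>) * (3 * (1 / e * (1 / e))))"
    using d sq ab e by (intro mult_left_mono mult_mono) auto
  also have "\<dots> = 3 / e\<^sup>2 * \<bar>x - y\<bar>" using e by (simp add: power2_eq_square)
  finally show ?thesis .
qed

text \<open>Taylor's formula has the second derivative at an intermediate point z. Moving it to x
  costs the Lipschitz constant of \<open>bump e\<close> times |h|, which makes the error cubic in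
  h.\<close>

lemma smooth_abs_taylor:
  assumes e: "0 < e"
  shows "\<bar>smooth_abs e (x + h) - smooth_abs e x - smooth_sg e x * h - bump e x * h\<^sup>2 / 2\<bar> \<le> 3 / e\<^sup>2 * \<bar>h\<bar> ^ 3"
proof (cases "h = 0")
  case False
  define d where "d = (\<lambda>m::nat. if m = 0 then smooth_abs e else if m = 1 then smooth_sg e else bump e)"
  obtain z where z: "\<bar>x - z\<bar> \<le> \<bar>h\<bar>"
    "smooth_abs e (x + h) = smooth_abs e x + smooth_sg e x * h + bump e z * h\<^sup>2 / 2"
  proof -
    have D: "\<forall>m t. m < 2 \<and> min x (x+h) \<le> t \<and> t \<le> max x (x+h) \<longrightarrow> DERIV (d m) t :> d (Suc m) t"
      by (auto simp: d_def less_2_cases_iff DERIV_smooth_abs[OF e] DERIV_smooth_sg[OF e])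
    have "\<exists>t. (if x + h < x then x + h < t \<and> t < x else x < t \<and> t < x + h) \<and>
      smooth_abs e (x + h) = (\<Sum>m<2. d m x / fact m * (x + h - x) ^ m) + d 2 t / fact 2 * (x + h - x) ^ 2"
      by (rule Taylor[OF _ _ D]) (use False in \<open>auto simp: d_def\<close>)
    then obtain t where "if x + h < x then x + h < t \<and> t < x else x < t \<and> t < x + h"
      "smooth_abs e (x + h) = (\<Sum>m<2. d m x / fact m * (x + h - x) ^ m) + d 2 t / fact 2 * (x + h - x) ^ 2"
      by blast
    then show ?thesis
      by (intro that[of t]) (auto simp: d_def numeral_2_eq_2 split: if_splits)
  qed
  have "\<bar>smooth_abs e (x + h) - smooth_abs e x - smooth_sg e x * h - bump e x * h\<^sup>2 / 2\<bar>
      = \<bar>bump e z - bump e x\<bar> * (h\<^sup>2 / 2)"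
    unfolding z(2) by (simp add: abs_mult left_diff_distrib[symmetric] diff_divide_distrib[symmetric])
  \<comment> \<open>The factor 1/2 is given away here.\<close>
  also have "\<dots> \<le> (3 / e\<^sup>2 * \<bar>h\<bar>) * h\<^sup>2"
  proof (intro mult_mono)
    have "\<bar>bump e z - bump e x\<bar> \<le> 3 / e\<^sup>2 * \<bar>z - x\<bar>" by (rule bump_lipschitz[OF e])
    also have "\<dots> \<le> 3 / e\<^sup>2 * \<bar>h\<bar>" using z(1) by (intro mult_left_mono) auto
    finally show "\<bar>bump e z - bump e x\<bar> \<le> 3 / e\<^sup>2 * \<bar>h\<bar>" .
  qed auto
  also have "\<dots> = 3 / e\<^sup>2 * \<bar>h\<bar> ^ 3" by (simp add: power3_eq_cube power2_eq_square)
  finally show ?thesis .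
qed simp

text \<open>Equal to 1 - (\<open>smooth_sg e\<close>)^2 when e > 0. It is a continuous majorant of
  the squared sign error, which itself jumps at 0, so that Riemann sums along a path can be taken to
  the limit.\<close>

definition hat :: "real \<Rightarrow> real \<Rightarrow> real" where
  "hat e x = e\<^sup>2 / (x\<^sup>2 + e\<^sup>2)"

lemma hat_nonneg: "0 \<le> hat e x" and hat_le_1: "hat e x \<le> 1"
  unfolding hat_def by (simp_all add: divide_le_eq_1 sum_power2_gt_zero_iff)

lemma isCont_hat: "0 < e \<Longrightarrow> isCont (hat e) x"
  unfolding hat_def by (intro continuous_intros) (auto simp: add_nonneg_eq_0_iff)

text \<open>With u = |x| / \<open>smooth_abs e x\<close> in [0, 1], the left side is (1 - u)^2, and
  one factor 1 - u is enlarged to 1 + u.\<close>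

lemma sg_diff_le_hat:
  assumes e: "0 < e" shows "(sg x - smooth_sg e x)\<^sup>2 \<le> hat e x"
proof -
  let ?a = "smooth_abs e x"
  let ?u = "\<bar>x\<bar> / ?a"
  have a: "0 < ?a" "\<bar>x\<bar> \<le> ?a" by (rule smooth_abs_pos[OF e], rule smooth_abs_ge)
  then have u: "0 \<le> ?u" "?u \<le> 1" by auto
  have "(sg x - smooth_sg e x)\<^sup>2 = (1 - ?u)\<^sup>2"
    unfolding sg_def smooth_sg_def by (auto simp: power2_eq_square algebra_simps abs_if)
  also have "\<dots> \<le> (1 - ?u) * (1 + ?u)"
    unfolding power2_eq_square using u by (intro mult_left_mono) auto
  also have "\<dots> = 1 - x\<^sup>2 / ?a\<^sup>2"
    by (simp add: algebra_simps power2_eq_square)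
  also have "\<dots> = hat e x"
    unfolding smooth_abs_sq hat_def using e by (simp add: field_simps add_nonneg_eq_0_iff)
  finally show ?thesis .
qed

text \<open>A discrete Tanaka formula: as \<open>e\<close> tends to \<open>0\<close>, \<open>smooth_abs e\<close> tends to the absolute value, its
  derivative \<open>smooth_sg e\<close> to the sign, and \<open>bump e\<close> to twice the Dirac measure at \<open>0\<close>.\<close>

lemma discrete_tanaka:
  assumes e: "0 < e"
  shows "\<bar>walk_ltime x n - (\<Sum>j<n. bump e (psum x j) * s) / 2\<bar>
    \<le> e + \<bar>\<Sum>j<n. (sg (psum x j) - smooth_sg e (psum x j)) * x j\<bar>
      + \<bar>\<Sum>j<n. bump e (psum x j) * ((x j)\<^sup>2 - s)\<bar> + 3 / e\<^sup>2 * (\<Sum>j<n. \<bar>x j\<bar> ^ 3)"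
proof -
  let ?X = "psum x"
  define R where "R j = smooth_abs e (?X j + x j) - smooth_abs e (?X j) - smooth_sg e (?X j) * x j
    - bump e (?X j) * (x j)\<^sup>2 / 2" for j
  let ?A = "\<Sum>j<n. (sg (?X j) - smooth_sg e (?X j)) * x j"
  let ?B = "\<Sum>j<n. bump e (?X j) * ((x j)\<^sup>2 - s)"
  have "(\<Sum>j<n. R j) = (\<Sum>j<n. smooth_abs e (?X (Suc j)) - smooth_abs e (?X j))
    - (\<Sum>j<n. smooth_sg e (?X j) * x j) - (\<Sum>j<n. bump e (?X j) * (x j)\<^sup>2) / 2"
    by (simp add: R_def sum_subtractf sum_divide_distrib)
  \<comment> \<open>The walk starts at 0, where \<open>smooth_abs e\<close> has the value e.\<close>
  also have "(\<Sum>j<n. smooth_abs e (?X (Suc j)) - smooth_abs e (?X j)) = smooth_abs e (?X n) - e"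
    using e by (subst sum_lessThan_telescope) (simp add: smooth_abs_def)
  finally have R: "(\<Sum>j<n. R j) = smooth_abs e (?X n) - e - (\<Sum>j<n. smooth_sg e (?X j) * x j)
    - (\<Sum>j<n. bump e (?X j) * (x j)\<^sup>2) / 2" .
  have fl: "psum (flip x) n = - (\<Sum>j<n. sg (?X j) * x j)"
    by (simp add: psum_def[of "flip x"] flip_def sum_negf)
  have "walk_ltime x n - (\<Sum>j<n. bump e (?X j) * s) / 2
      = (\<bar>?X n\<bar> - smooth_abs e (?X n) + e) - ?A + ?B / 2 + (\<Sum>j<n. R j)"
    unfolding R walk_ltime_def fl by (simp add: algebra_simps sum_subtractf diff_divide_distrib)
  moreover have "\<bar>\<bar>?X n\<bar> - smooth_abs e (?X n) + e\<bar> \<le> e"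
    using smooth_abs_ge(2)[of "?X n" e] smooth_abs_le[OF e, of "?X n"] by auto
  moreover have "\<bar>\<Sum>j<n. R j\<bar> \<le> 3 / e\<^sup>2 * (\<Sum>j<n. \<bar>x j\<bar> ^ 3)"
  proof -
    have "\<bar>\<Sum>j<n. R j\<bar> \<le> (\<Sum>j<n. \<bar>R j\<bar>)" by (rule sum_abs)
    also have "\<dots> \<le> (\<Sum>j<n. 3 / e\<^sup>2 * \<bar>x j\<bar> ^ 3)"
      unfolding R_def by (intro sum_mono smooth_abs_taylor[OF e])
    finally show ?thesis by (simp add: sum_distrib_left)
  qed
  ultimately show ?thesis by linarith
qed

section \<open>Occupation densities\<close>

lemma smooth_sg_at_top: "(smooth_sg 1 \<longlongrightarrow> 1) at_top"
proof (rule real_tendsto_sandwich[where f="\<lambda>x. 1 - inverse (1 + x)" and h="\<lambda>_. 1"])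
  have *: "1 - inverse (1 + x) \<le> smooth_sg 1 x \<and> smooth_sg 1 x \<le> 1" if "0 < x" for x :: real
  proof -
    have "smooth_abs 1 x \<le> x + 1" "x \<le> smooth_abs 1 x" "0 < smooth_abs 1 x"
      using smooth_abs_le[of 1 x] smooth_abs_ge(2)[of x 1] smooth_abs_pos[of 1 x] that by auto
    moreover have "1 - inverse (1 + x) = x / (x + 1)" using that by (simp add: field_simps)
    ultimately show ?thesis unfolding smooth_sg_def using that by (auto intro!: divide_left_mono)
  qed
  show "\<forall>\<^sub>F x in at_top. 1 - inverse (1 + x) \<le> smooth_sg 1 x"
    "\<forall>\<^sub>F x in at_top. smooth_sg 1 x \<le> 1"
    using eventually_gt_at_top[of 0] by (eventually_elim; use * in blast)+
  have "((\<lambda>x::real. inverse (1 + x)) \<longlongrightarrow> 0) at_top"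
    by (intro tendsto_inverse_0_at_top filterlim_tendsto_add_at_top[OF tendsto_const] filterlim_ident)
  from tendsto_diff[OF tendsto_const[of 1] this]
  show "((\<lambda>x::real. 1 - inverse (1 + x)) \<longlongrightarrow> 1) at_top" by simp
qed simp

lemma borel_measurable_bump [measurable]: "bump e \<in> borel_measurable borel"
  unfolding bump_def smooth_abs_def by measurable

lemma borel_measurable_hat [measurable]: "hat e \<in> borel_measurable borel"
  unfolding hat_def by measurable

text \<open>On the positive half-line the primitive \<open>smooth_sg 1\<close> rises from 0 to 1;
  the other half follows by evenness. The two closed half-lines overlap only in the null set
  {0}.\<close>

lemma nn_integral_bump_1: "(\<integral>\<^sup>+x. ennreal (bump 1 x) \<partial>lborel) = 2"
proof -
  have even: "bump 1 (- x) = bump 1 x" for x by (simp add: bump_def smooth_abs_def)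
  have half: "(\<integral>\<^sup>+x. ennreal (bump 1 x) * indicator {0..} x \<partial>lborel) = 1"
    by (subst nn_integral_FTC_atLeast[where F="smooth_sg 1" and T=1])
       (auto intro: DERIV_smooth_sg bump_nonneg smooth_sg_at_top simp: smooth_sg_def)
  also have "(\<integral>\<^sup>+x. ennreal (bump 1 x) * indicator {0..} x \<partial>lborel)
      = (\<integral>\<^sup>+x. ennreal (bump 1 x) * indicator {0..} (- x) \<partial>lborel)"
    by (subst nn_integral_real_affine[where c="-1" and t=0]) (simp_all add: even)
  finally have half': "(\<integral>\<^sup>+x. ennreal (bump 1 x) * indicator {0..} (- x) \<partial>lborel) = 1" .
  have "(\<integral>\<^sup>+x. ennreal (bump 1 x) \<partial>lborel)
      = (\<integral>\<^sup>+x. ennreal (bump 1 x) * indicator {0..} x + ennreal (bump 1 x) * indicator {0..} (- x) \<partial>lborel)"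
  proof (rule nn_integral_cong_AE)
    show "AE x in lborel. ennreal (bump 1 x)
      = ennreal (bump 1 x) * indicator {0..} x + ennreal (bump 1 x) * indicator {0..} (- x)"
      using AE_lborel_singleton[of "0::real"]
      by eventually_elim (auto simp: indicator_def not_le)
  qed
  also have "\<dots> = 1 + 1"
    by (subst nn_integral_add) (simp_all add: half half')
  finally show ?thesis by simp
qed

lemma bump_scale: "0 < e \<Longrightarrow> e * bump e (e * u) = bump 1 u"
proof -
  assume e: "0 < e"
  have "smooth_abs e (e * u) = sqrt (e\<^sup>2 * (u\<^sup>2 + 1))"
    unfolding smooth_abs_def by (simp add: algebra_simps power_mult_distrib)
  then have "smooth_abs e (e * u) = e * smooth_abs 1 u"
    using e unfolding smooth_abs_def real_sqrt_mult by simp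
  then show ?thesis
    using e unfolding bump_def by (simp add: power_mult_distrib power2_eq_square power3_eq_cube)
qed

text \<open>The substitution x = e * u turns the moving kernel into the fixed density
  \<open>bump 1\<close> and the argument of \<open>l\<close> into e * u; dominated convergence then
  uses the bound R. The function is only asked to be continuous at 0 because the lemma is applied to
  a truncated density.\<close>

lemma bump_approximate_identity:
  fixes l :: "real \<Rightarrow> real"
  assumes [measurable]: "l \<in> borel_measurable borel"
    and l: "\<And>x. 0 \<le> l x" "\<And>x. l x \<le> R" and cont: "isCont l 0"
  shows "(\<lambda>n. \<integral>\<^sup>+x. ennreal (bump (step n) x * l x) \<partial>lborel) \<longlonglongrightarrow> ennreal (2 * l 0)"
proof -
  have R: "0 \<le> R" using l[of 0] by linarith
  have scale: "(\<integral>\<^sup>+x. ennreal (bump e x * l x) \<partial>lborel) = (\<integral>\<^sup>+u. ennreal (bump 1 u * l (e * u)) \<partial>lborel)"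
    if e: "0 < e" for e
  proof -
    have "(\<integral>\<^sup>+x. ennreal (bump e x * l x) \<partial>lborel)
        = ennreal e * (\<integral>\<^sup>+u. ennreal (bump e (e * u) * l (e * u)) \<partial>lborel)"
      by (subst nn_integral_real_affine[where c=e and t=0]) (use e in auto)
    also have "\<dots> = (\<integral>\<^sup>+u. ennreal e * ennreal (bump e (e * u) * l (e * u)) \<partial>lborel)"
      by (rule nn_integral_cmult[symmetric]) measurable
    also have "\<dots> = (\<integral>\<^sup>+u. ennreal (bump 1 u * l (e * u)) \<partial>lborel)"
      using e bump_nonneg[OF e] l(1)
      by (intro nn_integral_cong) (simp add: ennreal_mult[symmetric] bump_scale[symmetric] mult.assoc)
    finally show ?thesis .
  qed
  have "(\<lambda>n. \<integral>\<^sup>+u. ennreal (bump 1 u * l (step n * u)) \<partial>lborel)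
      \<longlonglongrightarrow> (\<integral>\<^sup>+u. ennreal (bump 1 u * l 0) \<partial>lborel)"
  proof (rule nn_integral_dominated_convergence[where w="\<lambda>u. ennreal (bump 1 u * R)"])
    show "AE u in lborel. ennreal (bump 1 u * l (step j * u)) \<le> ennreal (bump 1 u * R)" for j
      using l bump_nonneg[of 1] by (intro AE_I2 ennreal_leI mult_left_mono) auto
    have "(\<integral>\<^sup>+u. ennreal (bump 1 u * R) \<partial>lborel) = 2 * ennreal R"
      using R bump_nonneg[of 1] by (simp add: ennreal_mult nn_integral_multc nn_integral_bump_1)
    then show "(\<integral>\<^sup>+u. ennreal (bump 1 u * R) \<partial>lborel) < \<infinity>"
      by (simp add: ennreal_mult_less_top)
    show "AE u in lborel. (\<lambda>i. ennreal (bump 1 u * l (step i * u))) \<longlonglongrightarrow> ennreal (bump 1 u * l 0)"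
    proof (rule AE_I2)
      fix u :: real
      have "(\<lambda>i. step i * u) \<longlonglongrightarrow> 0" using tendsto_mult_left_zero[OF step_tendsto_0] .
      then show "(\<lambda>i. ennreal (bump 1 u * l (step i * u))) \<longlonglongrightarrow> ennreal (bump 1 u * l 0)"
        by (intro tendsto_ennrealI tendsto_mult tendsto_const isCont_tendsto_compose[OF cont])
    qed
  qed measurable
  moreover have "(\<integral>\<^sup>+u. ennreal (bump 1 u * l 0) \<partial>lborel) = ennreal (2 * l 0)"
    using l(1) bump_nonneg[of 1] by (simp add: ennreal_mult nn_integral_multc nn_integral_bump_1)
  ultimately show ?thesis by (simp add: scale)
qed

text \<open>\<open>w\<close> is a path and \<open>l\<close> the density of its occupation measure up to time \<open>t\<close>.\<close>

context
  fixes w l :: "real \<Rightarrow> real" and t :: real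
  assumes w: "continuous_on {0..} w" and l: "continuous_on UNIV l" "\<And>x. 0 \<le> l x" and t: "0 \<le> t"
    and occ: "\<And>A. A \<in> sets borel \<Longrightarrow>
      (\<integral>\<^sup>+s\<in>{0..t}. indicator A (w s) \<partial>lborel) = (\<integral>\<^sup>+x\<in>A. ennreal (l x) \<partial>lborel)"
begin

lemma borel_density: "l \<in> borel_measurable borel"
  by (rule borel_measurable_continuous_onI[OF l(1)])

text \<open>The hypothesis on Borel sets identifies the image of Lebesgue measure on [0, t] under
  the path with the measure of density \<open>l\<close>; both are then integrated against
  \<open>g\<close>.\<close>

lemma occupation_formula:
  fixes g :: "real \<Rightarrow> real"
  assumes g: "\<And>x. 0 \<le> g x" "continuous_on UNIV g"
  shows "ennreal (integral {0..t} (\<lambda>s. g (w s))) = (\<integral>\<^sup>+x. ennreal (g x * l x) \<partial>lborel)"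
proof -
  note [measurable] = borel_density
  have [measurable]: "g \<in> borel_measurable borel" by (rule borel_measurable_continuous_onI[OF g(2)])
  \<comment> \<open>Nothing is known about \<open>w\<close> at negative times; freezing it there
    gives a continuous, hence Borel, function on the whole line.\<close>
  define v where "v s = w (max 0 s)" for s
  have "continuous_on UNIV v"
    unfolding v_def by (intro continuous_on_compose2[OF w] continuous_intros) auto
  then have [measurable]: "v \<in> borel_measurable borel"
    by (rule borel_measurable_continuous_onI)
  have "distr (density lborel (indicator {0..t})) borel v = density lborel (\<lambda>x. ennreal (l x))" (is "?L = ?R")
  proof (rule measure_eqI)
    fix A assume "A \<in> sets ?L"
    then have A [measurable]: "A \<in> sets borel" by simp
    have "emeasure ?L A = (\<integral>\<^sup>+s. indicator {0..t} s * indicator (v -` A) s \<partial>lborel)"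
      using measurable_sets_borel[of v borel A] by (simp add: emeasure_distr emeasure_density)
    also have "\<dots> = (\<integral>\<^sup>+s\<in>{0..t}. indicator A (w s) \<partial>lborel)"
      by (intro nn_integral_cong) (auto simp: v_def indicator_def max_def)
    also have "\<dots> = emeasure ?R A" unfolding occ[OF A] by (simp add: emeasure_density)
    finally show "emeasure ?L A = emeasure ?R A" .
  qed simp
  then have "(\<integral>\<^sup>+x. ennreal (g x) \<partial>?L) = (\<integral>\<^sup>+x. ennreal (g x) \<partial>?R)" by simp
  then have "(\<integral>\<^sup>+s. indicator {0..t} s * ennreal (g (v s)) \<partial>lborel)
      = (\<integral>\<^sup>+x. ennreal (l x) * ennreal (g x) \<partial>lborel)"
    by (simp add: nn_integral_distr nn_integral_density)
  moreover have "(\<integral>\<^sup>+x. ennreal (l x) * ennreal (g x) \<partial>lborel) = (\<integral>\<^sup>+x. ennreal (g x * l x) \<partial>lborel)"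
    using g(1) l(2) by (simp add: ennreal_mult mult.commute)
  moreover have "(\<integral>\<^sup>+s. indicator {0..t} s * ennreal (g (v s)) \<partial>lborel) = ennreal (integral {0..t} (\<lambda>s. g (w s)))"
  proof -
    have "continuous_on {0..t} (\<lambda>s. g (w s))"
      by (intro continuous_on_compose2[OF g(2)] continuous_on_subset[OF w]) auto
    then have si: "set_integrable lborel {0..t} (\<lambda>s. g (w s))"
      by (rule borel_integrable_atLeastAtMost')
    have "(\<integral>\<^sup>+s. indicator {0..t} s * ennreal (g (v s)) \<partial>lborel)
        = (\<integral>\<^sup>+s. ennreal (indicator {0..t} s *\<^sub>R g (w s)) \<partial>lborel)"
      by (intro nn_integral_cong) (auto simp: v_def indicator_def max_def)
    also have "\<dots> = ennreal (LINT s:{0..t}|lborel. g (w s))"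
      unfolding set_lebesgue_integral_def
      using si g(1) by (intro nn_integral_eq_integral) (auto simp: set_integrable_def)
    also have "\<dots> = ennreal (integral {0..t} (\<lambda>s. g (w s)))"
      using set_borel_integral_eq_integral(2)[OF si] by simp
    finally show ?thesis .
  qed
  ultimately show ?thesis by simp
qed

lemma total_occupation: "(\<integral>\<^sup>+x. ennreal (l x) \<partial>lborel) = ennreal t"
  using occupation_formula[of "\<lambda>_. 1"] t by simp

text \<open>In the limit \<open>hat\<close> is the indicator of {0}, a Lebesgue null set, so the
  path spends no time there. The integrable majorant is the density \<open>l\<close> itself.\<close>

lemma hat_occupation_tendsto: "(\<lambda>n. integral {0..t} (\<lambda>s. hat (step n) (w s))) \<longlonglongrightarrow> 0"
proof -
  note [measurable] = borel_density
  have c: "continuous_on UNIV (hat e)" if "0 < e" for e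
    using isCont_hat[OF that] by (simp add: continuous_on_eq_continuous_at)
  have nn: "0 \<le> integral {0..t} (\<lambda>s. hat (step n) (w s))" for n
    by (intro integral_nonneg integrable_continuous_real continuous_on_compose2[OF c] continuous_on_subset[OF w])
       (auto simp: hat_nonneg)
  have "(\<lambda>n. \<integral>\<^sup>+x. ennreal (hat (step n) x * l x) \<partial>lborel) \<longlonglongrightarrow> (\<integral>\<^sup>+x. 0 \<partial>(lborel::real measure))"
  proof (rule nn_integral_dominated_convergence[where w="\<lambda>x. ennreal (l x)"])
    show "AE x in lborel. ennreal (hat (step j) x * l x) \<le> ennreal (l x)" for j
      using hat_le_1 hat_nonneg l(2) by (intro AE_I2 ennreal_leI mult_left_le_one_le) auto
    show "(\<integral>\<^sup>+x. ennreal (l x) \<partial>lborel) < \<infinity>" by (simp add: total_occupation)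
    show "AE x in lborel. (\<lambda>i. ennreal (hat (step i) x * l x)) \<longlonglongrightarrow> 0"
      using AE_lborel_singleton[of "0::real"]
    proof eventually_elim
      case (elim x)
      have "(\<lambda>i. (step i)\<^sup>2 / (x\<^sup>2 + (step i)\<^sup>2) * l x) \<longlonglongrightarrow> 0\<^sup>2 / (x\<^sup>2 + 0\<^sup>2) * l x"
        by (intro tendsto_intros step_tendsto_0) (use elim in auto)
      then have "(\<lambda>i. hat (step i) x * l x) \<longlonglongrightarrow> 0" by (simp add: hat_def)
      from tendsto_ennrealI[OF this] show ?case by simp
    qed
  qed measurable
  then have "(\<lambda>n. ennreal (integral {0..t} (\<lambda>s. hat (step n) (w s)))) \<longlonglongrightarrow> ennreal 0"
    by (simp add: occupation_formula[OF hat_nonneg c])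
  then show ?thesis using nn by (subst (asm) tendsto_ennreal_iff) auto
qed

text \<open>The division by 2 compensates the mass of \<open>bump\<close>. The approximate identity
  asks for a bounded function, so the density is cut off outside [-1, 1]; on the part removed,
  \<open>bump e\<close> is at most e^2 and the density has total mass t.\<close>

lemma bump_occupation_tendsto: "(\<lambda>n. integral {0..t} (\<lambda>s. bump (step n) (w s)) / 2) \<longlonglongrightarrow> l 0"
proof -
  note [measurable] = borel_density
  have c: "continuous_on UNIV (bump e)" if "0 < e" for e
    using isCont_bump[OF that] by (simp add: continuous_on_eq_continuous_at)
  have nn: "0 \<le> integral {0..t} (\<lambda>s. bump (step n) (w s))" for n
    by (intro integral_nonneg integrable_continuous_real continuous_on_compose2[OF c] continuous_on_subset[OF w])
       (auto simp: bump_nonneg)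
  define k where "k x = l x * indicator {-1..1} x" for x
  have k [measurable]: "k \<in> borel_measurable borel" unfolding k_def by measurable
  obtain R where R: "\<And>x. x \<in> {-1..1} \<Longrightarrow> l x \<le> R"
    using continuous_attains_sup[of "{-1..1::real}" l] continuous_on_subset[OF l(1), of "{-1..1}"]
    by (auto simp del: atLeastAtMost_iff)
  have near: "(\<lambda>n. \<integral>\<^sup>+x. ennreal (bump (step n) x * k x) \<partial>lborel) \<longlonglongrightarrow> ennreal (2 * k 0)"
  proof (rule bump_approximate_identity)
    show "0 \<le> k x" for x using l(2) by (simp add: k_def)
    \<comment> \<open>Outside [-1, 1] this is 0 \<le> R, which comes from the values at 0.\<close>
    show "k x \<le> R" for x using R[of x] R[of 0] l(2)[of 0] by (auto simp: k_def indicator_def)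
    have "\<forall>\<^sub>F x in nhds 0. x \<in> {-1<..<1::real}" by (rule eventually_nhds_in_open) auto
    then have "\<forall>\<^sub>F x in nhds 0. k x = l x" by eventually_elim (auto simp: k_def)
    then have "isCont k 0 \<longleftrightarrow> isCont l 0" by (rule isCont_cong)
    then show "isCont k 0" using l(1) by (simp add: continuous_on_eq_continuous_at)
  qed measurable
  have far: "(\<lambda>n. \<integral>\<^sup>+x. ennreal (bump (step n) x * (l x - k x)) \<partial>lborel) \<longlonglongrightarrow> 0"
  proof (rule tendsto_sandwich[where f="\<lambda>_. 0" and h="\<lambda>n. ennreal ((step n)\<^sup>2 * t)"])
    show "\<forall>\<^sub>F n in sequentially. (\<integral>\<^sup>+x. ennreal (bump (step n) x * (l x - k x)) \<partial>lborel) \<le> ennreal ((step n)\<^sup>2 * t)"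
    proof (rule always_eventually, rule allI)
      fix n
      have "bump (step n) x * (l x - k x) \<le> (step n)\<^sup>2 * l x" for x
      proof (cases "x \<in> {-1..1}")
        case True
        then show ?thesis using l(2)[of x] by (simp add: k_def)
      next
        case False
        then have "1 \<le> smooth_abs (step n) x" using smooth_abs_ge(2)[of x "step n"] by auto
        then have "1 \<le> smooth_abs (step n) x ^ 3" by (rule one_le_power)
        then have "bump (step n) x \<le> (step n)\<^sup>2 / 1"
          unfolding bump_def using smooth_abs_pos[of "step n" x] by (intro divide_left_mono) auto
        then show ?thesis using False l(2)[of x] by (auto simp: k_def intro!: mult_right_mono)
      qed
      then have "(\<integral>\<^sup>+x. ennreal (bump (step n) x * (l x - k x)) \<partial>lborel)
          \<le> (\<integral>\<^sup>+x. ennreal ((step n)\<^sup>2 * l x) \<partial>lborel)"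
        by (intro nn_integral_mono ennreal_leI) auto
      also have "\<dots> = ennreal ((step n)\<^sup>2 * t)"
        using l(2) t by (simp add: ennreal_mult nn_integral_cmult total_occupation)
      finally show "(\<integral>\<^sup>+x. ennreal (bump (step n) x * (l x - k x)) \<partial>lborel) \<le> ennreal ((step n)\<^sup>2 * t)" .
    qed
    have "(\<lambda>n. (step n)\<^sup>2 * t) \<longlonglongrightarrow> 0\<^sup>2 * t" by (intro tendsto_intros step_tendsto_0)
    from tendsto_ennrealI[OF this] show "(\<lambda>n. ennreal ((step n)\<^sup>2 * t)) \<longlonglongrightarrow> 0" by simp
  qed auto
  have "ennreal (integral {0..t} (\<lambda>s. bump (step n) (w s)))
      = (\<integral>\<^sup>+x. ennreal (bump (step n) x * k x) \<partial>lborel) + (\<integral>\<^sup>+x. ennreal (bump (step n) x * (l x - k x)) \<partial>lborel)" for n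
  proof -
    have kl: "0 \<le> k x" "0 \<le> l x - k x" for x using l(2)[of x] by (auto simp: k_def indicator_def)
    have "(\<integral>\<^sup>+x. ennreal (bump (step n) x * l x) \<partial>lborel)
        = (\<integral>\<^sup>+x. ennreal (bump (step n) x * k x) + ennreal (bump (step n) x * (l x - k x)) \<partial>lborel)"
      using kl bump_nonneg[of "step n"]
      by (intro nn_integral_cong) (simp add: ennreal_plus[symmetric] distrib_left[symmetric] del: ennreal_plus)
    also have "\<dots> = (\<integral>\<^sup>+x. ennreal (bump (step n) x * k x) \<partial>lborel) + (\<integral>\<^sup>+x. ennreal (bump (step n) x * (l x - k x)) \<partial>lborel)"
      by (rule nn_integral_add) measurable
    finally show ?thesis by (simp add: occupation_formula[OF bump_nonneg c])
  qed
  then have "(\<lambda>n. ennreal (integral {0..t} (\<lambda>s. bump (step n) (w s)))) \<longlonglongrightarrow> ennreal (2 * l 0)"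
    using tendsto_add[OF near far] by (simp add: k_def)
  then have "(\<lambda>n. integral {0..t} (\<lambda>s. bump (step n) (w s))) \<longlonglongrightarrow> 2 * l 0"
    using nn l(2)[of 0] by (subst (asm) tendsto_ennreal_iff) auto
  from tendsto_divide[OF this tendsto_const[of 2]] show ?thesis by simp
qed

end

section \<open>Testing equality of laws\<close>

text \<open>A k-Lipschitz majorant of the indicator of A that, for nonempty A, vanishes at distance
  1/k and beyond. For empty A it is constantly 1, since \<open>infdist\<close> is then 0 by
  convention; the empty set therefore needs separate treatment.\<close>

definition near :: "nat \<Rightarrow> 'c::metric_space set \<Rightarrow> 'c \<Rightarrow> real" where
  "near k A y = max 0 (1 - real k * infdist y A)"

lemma near_bounds: "0 \<le> near k A y" "near k A y \<le> 1"
  by (auto simp: near_def infdist_nonneg)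

lemma near_lipschitz: "\<bar>near k A x - near k A y\<bar> \<le> real k * dist x y"
proof -
  have "\<bar>near k A x - near k A y\<bar> \<le> \<bar>real k * infdist x A - real k * infdist y A\<bar>"
    unfolding near_def by linarith
  also have "\<dots> = real k * \<bar>infdist x A - infdist y A\<bar>"
    by (simp add: right_diff_distrib[symmetric] abs_mult)
  also have "\<dots> \<le> real k * dist x y"
    by (intro mult_left_mono infdist_triangle_abs) auto
  finally show ?thesis .
qed

lemma borel_measurable_near [measurable]: "near k A \<in> borel_measurable borel"
  unfolding near_def by (intro borel_measurable_continuous_onI continuous_intros)

lemma near_tendsto_indicator:
  assumes "closed A" "A \<noteq> {}"
  shows "(\<lambda>k. near k A y) \<longlonglongrightarrow> indicator A y"
proof (cases "y \<in> A")
  case True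
  then show ?thesis by (simp add: near_def)
next
  case False
  then have p: "0 < infdist y A"
    using in_closed_iff_infdist_zero[OF assms] infdist_nonneg[of y A] by (metis less_eq_real_def)
  have "\<forall>\<^sub>F k in sequentially. 1 / infdist y A < real k"
    by (rule filterlim_real_sequentially[THEN filterlim_at_top_dense[THEN iffD1], rule_format])
  then have "\<forall>\<^sub>F k in sequentially. near k A y = 0"
    by eventually_elim (use p in \<open>auto simp: near_def field_simps\<close>)
  then show ?thesis using False by (simp add: tendsto_eventually)
qed

lemma (in prob_space) near_integral_tendsto:
  fixes X :: "'i \<Rightarrow> 'a \<Rightarrow> 'c::metric_space"
  assumes J: "finite J" and X [measurable]: "\<And>i. i \<in> J \<Longrightarrow> X i \<in> borel_measurable M"
    and A: "\<And>i. i \<in> J \<Longrightarrow> closed (A i)" "\<And>i. i \<in> J \<Longrightarrow> A i \<noteq> {}"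
  shows "(\<lambda>k. expectation (\<lambda>\<omega>. \<Prod>i\<in>J. near k (A i) (X i \<omega>)))
    \<longlonglongrightarrow> prob {\<omega> \<in> space M. \<forall>i\<in>J. X i \<omega> \<in> A i}"
proof -
  have [measurable]: "A i \<in> sets borel" if "i \<in> J" for i using A(1)[OF that] by simp
  have B: "{\<omega> \<in> space M. \<forall>i\<in>J. X i \<omega> \<in> A i} \<in> sets M"
    using J by (intro sets.sets_Collect_finite_All) measurable
  have ind: "(\<Prod>i\<in>J. indicator (A i) (X i \<omega>)) = (indicator {\<omega> \<in> space M. \<forall>i\<in>J. X i \<omega> \<in> A i} \<omega> :: real)"
    if "\<omega> \<in> space M" for \<omega>
  proof (cases "\<forall>i\<in>J. X i \<omega> \<in> A i")
    case False
    then have "(\<Prod>i\<in>J. indicator (A i) (X i \<omega>)) = (0 :: real)"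
      using J by (intro prod_zero) (auto intro: bexI[rotated])
    then show ?thesis using False by auto
  qed (use that in auto)
  have "(\<lambda>k. expectation (\<lambda>\<omega>. \<Prod>i\<in>J. near k (A i) (X i \<omega>)))
      \<longlonglongrightarrow> expectation (\<lambda>\<omega>. \<Prod>i\<in>J. indicator (A i) (X i \<omega>) :: real)"
  proof (rule integral_dominated_convergence[where w="\<lambda>_. 1"])
    show "AE \<omega> in M. (\<lambda>k. \<Prod>i\<in>J. near k (A i) (X i \<omega>)) \<longlonglongrightarrow> (\<Prod>i\<in>J. indicator (A i) (X i \<omega>))"
      by (intro AE_I2 tendsto_prod near_tendsto_indicator A)
    show "AE \<omega> in M. norm (\<Prod>i\<in>J. near k (A i) (X i \<omega>)) \<le> 1" for k
      by (intro AE_I2) (auto simp: abs_prod near_bounds intro!: prod_le_1)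
  qed (auto intro!: borel_measurable_prod measurable_compose[OF X borel_measurable_near] borel_measurable_indicator')
  also have "expectation (\<lambda>\<omega>. \<Prod>i\<in>J. indicator (A i) (X i \<omega>) :: real)
      = expectation (indicator {\<omega> \<in> space M. \<forall>i\<in>J. X i \<omega> \<in> A i})"
    by (intro Bochner_Integration.integral_cong refl ind)
  also have "\<dots> = prob {\<omega> \<in> space M. \<forall>i\<in>J. X i \<omega> \<in> A i}"
    using B by simp
  finally show ?thesis .
qed

text \<open>Cylinders over finitely many closed sets form an intersection-stable generator, and
  their probabilities are limits of expectations of products of \<open>near\<close>. Lipschitz test
  functions are used because, unlike indicators, they pass through convergence in
  probability.\<close>

lemma distr_PiM_eqI:
  fixes X :: "'i \<Rightarrow> 'a \<Rightarrow> 'c::metric_space" and Y :: "'i \<Rightarrow> 'b \<Rightarrow> 'c"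
  assumes M: "prob_space M" and N: "prob_space N"
    and X [measurable]: "\<And>i. i \<in> I \<Longrightarrow> X i \<in> borel_measurable M"
    and Y [measurable]: "\<And>i. i \<in> I \<Longrightarrow> Y i \<in> borel_measurable N"
    and eq: "\<And>J A k. finite J \<Longrightarrow> J \<subseteq> I \<Longrightarrow>
      (\<integral>\<omega>. (\<Prod>i\<in>J. near k (A i) (X i \<omega>)) \<partial>M) = (\<integral>\<omega>. (\<Prod>i\<in>J. near k (A i) (Y i \<omega>)) \<partial>N)"
  shows "distr M (PiM I (\<lambda>_. borel)) (\<lambda>\<omega>. \<lambda>i\<in>I. X i \<omega>) = distr N (PiM I (\<lambda>_. borel)) (\<lambda>\<omega>. \<lambda>i\<in>I. Y i \<omega>)"
    (is "?P = ?Q")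
proof -
  interpret M: prob_space M by fact
  interpret N: prob_space N by fact
  let ?\<Omega> = "\<Pi>\<^sub>E i\<in>I. (UNIV :: 'c set)"
  define E where "E = {{f \<in> ?\<Omega>. \<forall>i\<in>j. f i \<in> A i} |A j. j \<in> {j. finite j \<and> j \<subseteq> I} \<and> A \<in> Pi j (\<lambda>_. Collect closed)}"
  have "sets (PiM I (\<lambda>_. borel :: 'c measure)) = sets (PiM I (\<lambda>_. sigma UNIV (Collect closed)))"
    by (simp add: borel_eq_closed)
  also have "\<dots> = sets (sigma ?\<Omega> E)"
    unfolding E_def
  proof (rule sets_PiM_sigma)
    show "\<exists>S\<subseteq>Collect closed. countable S \<and> (UNIV :: 'c set) = \<Union>S"
      by (rule exI[of _ "{UNIV}"]) auto
    show "\<Union>{j. finite j \<and> j \<subseteq> I} = I" by (auto intro: exI[of _ "{x}" for x])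
  qed auto
  also have "\<dots> = sigma_sets ?\<Omega> E"
    by (rule sets_measure_of) (auto simp: E_def)
  finally have sets: "sets (PiM I (\<lambda>_. borel :: 'c measure)) = sigma_sets ?\<Omega> E" .
  have Xm: "(\<lambda>\<omega>. \<lambda>i\<in>I. X i \<omega>) \<in> measurable M (PiM I (\<lambda>_. borel))"
    and Ym: "(\<lambda>\<omega>. \<lambda>i\<in>I. Y i \<omega>) \<in> measurable N (PiM I (\<lambda>_. borel))"
    by (intro measurable_restrict X Y; assumption)+
  have \<Omega>: "?\<Omega> \<in> E"
    unfolding E_def by (rule CollectI, rule exI[of _ "\<lambda>_. UNIV"], rule exI[of _ "{}"]) auto
  show ?thesis
  proof (rule measure_eqI_generator_eq[of E ?\<Omega> _ _ "\<lambda>_. ?\<Omega>"])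
    show "Int_stable E"
    proof (rule Int_stableI)
      fix S T assume "S \<in> E" "T \<in> E"
      then obtain A j B k where S: "S = {f \<in> ?\<Omega>. \<forall>i\<in>j. f i \<in> A i}" "finite j" "j \<subseteq> I" "\<And>i. i \<in> j \<Longrightarrow> closed (A i)"
        and T: "T = {f \<in> ?\<Omega>. \<forall>i\<in>k. f i \<in> B i}" "finite k" "k \<subseteq> I" "\<And>i. i \<in> k \<Longrightarrow> closed (B i)"
        unfolding E_def by (auto simp: Pi_iff)
      \<comment> \<open>Both cylinders are written over the common index set, with no constraint at
        the coordinates that one of them ignores.\<close>
      define C where "C i = (if i \<in> j then A i else UNIV) \<inter> (if i \<in> k then B i else UNIV)" for i
      have "S \<inter> T = {f \<in> ?\<Omega>. \<forall>i\<in>j \<union> k. f i \<in> C i}"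
        unfolding S(1) T(1) C_def by (auto split: if_splits)
      moreover have "C \<in> Pi (j \<union> k) (\<lambda>_. Collect closed)"
        using S(4) T(4) by (auto simp: C_def intro!: closed_Int)
      ultimately show "S \<inter> T \<in> E"
        unfolding E_def using S(2,3) T(2,3)
        by (intro CollectI exI[of _ C] exI[of _ "j \<union> k"]) auto
    qed
    show "E \<subseteq> Pow ?\<Omega>" by (auto simp: E_def)
    show "sets ?P = sigma_sets ?\<Omega> E" "sets ?Q = sigma_sets ?\<Omega> E" by (simp_all add: sets)
    show "range (\<lambda>_. ?\<Omega>) \<subseteq> E" using \<Omega> by auto
    show "emeasure ?P ?\<Omega> \<noteq> \<infinity>" for i
      using prob_space.emeasure_space_1[OF M.prob_space_distr[OF Xm]] by (simp add: space_PiM)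
    fix S assume SE: "S \<in> E"
    then obtain A j where S: "S = {f \<in> ?\<Omega>. \<forall>i\<in>j. f i \<in> A i}" "finite j" "j \<subseteq> I" "\<And>i. i \<in> j \<Longrightarrow> closed (A i)"
      unfolding E_def by (auto simp: Pi_iff)
    show "emeasure ?P S = emeasure ?Q S"
    proof (cases "\<exists>i\<in>j. A i = {}")
      case True
      then have "S = {}" using S(1) by auto
      then show ?thesis by simp
    next
      case False
      have Sm: "S \<in> sets (PiM I (\<lambda>_. borel :: 'c measure))"
        unfolding sets using SE by (rule sigma_sets.Basic)
      have "M.prob {\<omega> \<in> space M. \<forall>i\<in>j. X i \<omega> \<in> A i} = N.prob {\<omega> \<in> space N. \<forall>i\<in>j. Y i \<omega> \<in> A i}"
      proof (rule LIMSEQ_unique)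
        show "(\<lambda>k. M.expectation (\<lambda>\<omega>. \<Prod>i\<in>j. near k (A i) (X i \<omega>))) \<longlonglongrightarrow> M.prob {\<omega> \<in> space M. \<forall>i\<in>j. X i \<omega> \<in> A i}"
          using S False by (intro M.near_integral_tendsto) auto
        show "(\<lambda>k. M.expectation (\<lambda>\<omega>. \<Prod>i\<in>j. near k (A i) (X i \<omega>))) \<longlonglongrightarrow> N.prob {\<omega> \<in> space N. \<forall>i\<in>j. Y i \<omega> \<in> A i}"
          unfolding eq[OF S(2,3)] using S False by (intro N.near_integral_tendsto) auto
      qed
      moreover have "(\<lambda>\<omega>. \<lambda>i\<in>I. X i \<omega>) -` S \<inter> space M = {\<omega> \<in> space M. \<forall>i\<in>j. X i \<omega> \<in> A i}"
        "(\<lambda>\<omega>. \<lambda>i\<in>I. Y i \<omega>) -` S \<inter> space N = {\<omega> \<in> space N. \<forall>i\<in>j. Y i \<omega> \<in> A i}"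
        using S(1,3) by auto
      ultimately show ?thesis
        by (simp add: emeasure_distr[OF Xm Sm] emeasure_distr[OF Ym Sm] M.emeasure_eq_measure N.emeasure_eq_measure)
    qed
  qed auto
qed

section \<open>Convergence in probability\<close>

text \<open>For random variables on a probability space this is convergence in probability,
  expressed by one metric. The Bochner integral of a non-measurable function is 0, so the lemmas
  below ask for measurability separately.\<close>

definition tendsto_prob :: "'a measure \<Rightarrow> (nat \<Rightarrow> 'a \<Rightarrow> 'b::metric_space) \<Rightarrow> ('a \<Rightarrow> 'b) \<Rightarrow> bool" where
  "tendsto_prob M Z Y \<longleftrightarrow> (\<lambda>n. \<integral>\<omega>. min 1 (dist (Z n \<omega>) (Y \<omega>)) \<partial>M) \<longlonglongrightarrow> 0"

text \<open>The function \<open>lim\<close> is measurable without exception, and the preimages under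
  it and under \<open>g\<close> differ by a null set only. This yields the measurability of path
  functionals such as the running maximum.\<close>

lemma (in complete_measure) borel_measurable_AE_limit:
  fixes f :: "nat \<Rightarrow> 'a \<Rightarrow> real"
  assumes f [measurable]: "\<And>n. f n \<in> borel_measurable M"
    and lim: "AE \<omega> in M. (\<lambda>n. f n \<omega>) \<longlonglongrightarrow> g \<omega>"
  shows "g \<in> borel_measurable M"
proof (rule measurableI)
  fix A :: "real set" assume A [measurable]: "A \<in> sets borel"
  have "AE \<omega> in M. lim (\<lambda>n. f n \<omega>) = g \<omega>"
    using lim by eventually_elim (rule limI)
  then have "AE \<omega> in M. \<omega> \<in> (\<lambda>\<omega>. lim (\<lambda>n. f n \<omega>)) -` A \<inter> space M \<longleftrightarrow> \<omega> \<in> g -` A \<inter> space M"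
    by eventually_elim auto
  then show "g -` A \<inter> space M \<in> sets M"
    by (rule in_sets_AE) (use measurable_sets[OF borel_measurable_lim_metric[OF f] A] in auto)
qed simp

context prob_space
begin

lemma AE_tendsto_prob:
  fixes Z :: "nat \<Rightarrow> 'a \<Rightarrow> real"
  assumes [measurable]: "\<And>n. Z n \<in> borel_measurable M" "Y \<in> borel_measurable M"
    and lim: "AE \<omega> in M. (\<lambda>n. Z n \<omega>) \<longlonglongrightarrow> Y \<omega>"
  shows "tendsto_prob M Z Y"
proof -
  have "(\<lambda>n. expectation (\<lambda>\<omega>. min 1 (dist (Z n \<omega>) (Y \<omega>)))) \<longlonglongrightarrow> expectation (\<lambda>\<omega>. 0)"
  proof (rule integral_dominated_convergence[where w="\<lambda>_. 1"])
    show "AE \<omega> in M. (\<lambda>n. min 1 (dist (Z n \<omega>) (Y \<omega>))) \<longlonglongrightarrow> 0"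
      using lim
    proof eventually_elim
      case (elim \<omega>)
      have "(\<lambda>n. min 1 (dist (Z n \<omega>) (Y \<omega>))) \<longlonglongrightarrow> min 1 (dist (Y \<omega>) (Y \<omega>))"
        by (intro tendsto_intros elim)
      then show ?case by simp
    qed
  qed auto
  then show ?thesis by (simp add: tendsto_prob_def)
qed

lemma integrable_min_1 [simp]:
  fixes Z :: "'a \<Rightarrow> real"
  assumes [measurable]: "Z \<in> borel_measurable M" and "\<And>\<omega>. 0 \<le> Z \<omega>"
  shows "integrable M (\<lambda>\<omega>. min 1 (Z \<omega>))"
  using assms(2) by (intro integrable_const_bound[where B=1]) auto

lemma tendsto_prob_sandwich:
  fixes Z :: "nat \<Rightarrow> 'a \<Rightarrow> 'b::{second_countable_topology, metric_space}"
    and Z1 :: "nat \<Rightarrow> 'a \<Rightarrow> real" and Z2 :: "nat \<Rightarrow> 'a \<Rightarrow> real"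
  assumes Z1: "tendsto_prob M Z1 Y1" and Z2: "tendsto_prob M Z2 Y2"
    and [measurable]: "\<And>n. Z n \<in> borel_measurable M" "Y \<in> borel_measurable M"
      "\<And>n. Z1 n \<in> borel_measurable M" "Y1 \<in> borel_measurable M"
      "\<And>n. Z2 n \<in> borel_measurable M" "Y2 \<in> borel_measurable M"
    and bound: "\<And>n \<omega>. dist (Z n \<omega>) (Y \<omega>) \<le> dist (Z1 n \<omega>) (Y1 \<omega>) + dist (Z2 n \<omega>) (Y2 \<omega>)"
  shows "tendsto_prob M Z Y"
  unfolding tendsto_prob_def
proof (rule real_tendsto_sandwich[where f="\<lambda>_. 0"])
  show "(\<lambda>n. expectation (\<lambda>\<omega>. min 1 (dist (Z1 n \<omega>) (Y1 \<omega>))) + expectation (\<lambda>\<omega>. min 1 (dist (Z2 n \<omega>) (Y2 \<omega>)))) \<longlonglongrightarrow> 0"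
    using tendsto_add[OF Z1[unfolded tendsto_prob_def] Z2[unfolded tendsto_prob_def]] by simp
  show "\<forall>\<^sub>F n in sequentially. expectation (\<lambda>\<omega>. min 1 (dist (Z n \<omega>) (Y \<omega>)))
      \<le> expectation (\<lambda>\<omega>. min 1 (dist (Z1 n \<omega>) (Y1 \<omega>))) + expectation (\<lambda>\<omega>. min 1 (dist (Z2 n \<omega>) (Y2 \<omega>)))"
  proof (rule always_eventually, rule allI)
    fix n
    have "expectation (\<lambda>\<omega>. min 1 (dist (Z n \<omega>) (Y \<omega>)))
        \<le> expectation (\<lambda>\<omega>. min 1 (dist (Z1 n \<omega>) (Y1 \<omega>)) + min 1 (dist (Z2 n \<omega>) (Y2 \<omega>)))"
    proof (rule integral_mono)
      fix \<omega>
      show "min 1 (dist (Z n \<omega>) (Y \<omega>)) \<le> min 1 (dist (Z1 n \<omega>) (Y1 \<omega>)) + min 1 (dist (Z2 n \<omega>) (Y2 \<omega>))"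
        using bound[of n \<omega>] zero_le_dist[of "Z1 n \<omega>" "Y1 \<omega>"] zero_le_dist[of "Z2 n \<omega>" "Y2 \<omega>"] by linarith
    qed (auto intro!: Bochner_Integration.integrable_add)
    also have "\<dots> = expectation (\<lambda>\<omega>. min 1 (dist (Z1 n \<omega>) (Y1 \<omega>))) + expectation (\<lambda>\<omega>. min 1 (dist (Z2 n \<omega>) (Y2 \<omega>)))"
      by (rule Bochner_Integration.integral_add) auto
    finally show "expectation (\<lambda>\<omega>. min 1 (dist (Z n \<omega>) (Y \<omega>)))
      \<le> expectation (\<lambda>\<omega>. min 1 (dist (Z1 n \<omega>) (Y1 \<omega>))) + expectation (\<lambda>\<omega>. min 1 (dist (Z2 n \<omega>) (Y2 \<omega>)))" .
  qed
  show "\<forall>\<^sub>F n in sequentially. 0 \<le> expectation (\<lambda>\<omega>. min 1 (dist (Z n \<omega>) (Y \<omega>)))"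
    by (intro always_eventually allI Bochner_Integration.integral_nonneg) auto
qed (rule tendsto_const)

text \<open>A form of Chebyshev's inequality: pointwise |Z| \<le> e + Z^2 / e, by distinguishing
  whether |Z| exceeds e. With b = e^2 the bound becomes 2 * e.\<close>

lemma expectation_min_1_le_square:
  fixes Z :: "'a \<Rightarrow> real"
  assumes [measurable]: "Z \<in> borel_measurable M"
    and q: "(\<integral>\<^sup>+\<omega>. ennreal ((Z \<omega>)\<^sup>2) \<partial>M) \<le> ennreal b" and b: "0 \<le> b" and e: "0 < e"
  shows "expectation (\<lambda>\<omega>. min 1 \<bar>Z \<omega>\<bar>) \<le> e + b / e"
proof -
  have int: "integrable M (\<lambda>\<omega>. (Z \<omega>)\<^sup>2)"
    using q by (intro integrableI_nonneg) (auto simp: le_less_trans[OF _ ennreal_less_top])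
  have "ennreal (expectation (\<lambda>\<omega>. (Z \<omega>)\<^sup>2)) \<le> ennreal b"
    using q nn_integral_eq_integral[OF int] by simp
  then have le: "expectation (\<lambda>\<omega>. (Z \<omega>)\<^sup>2) \<le> b" using b by simp
  have "expectation (\<lambda>\<omega>. min 1 \<bar>Z \<omega>\<bar>) \<le> expectation (\<lambda>\<omega>. e + (Z \<omega>)\<^sup>2 / e)"
  proof (rule integral_mono)
    fix \<omega>
    show "min 1 \<bar>Z \<omega>\<bar> \<le> e + (Z \<omega>)\<^sup>2 / e"
    proof (cases "\<bar>Z \<omega>\<bar> \<le> e")
      case True
      then show ?thesis using e by (auto intro: order_trans[of _ "\<bar>Z \<omega>\<bar>"] add_increasing2)
    next
      case False
      then have "\<bar>Z \<omega>\<bar> * e \<le> \<bar>Z \<omega>\<bar> * \<bar>Z \<omega>\<bar>" using e by (intro mult_left_mono) auto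
      then have "\<bar>Z \<omega>\<bar> \<le> (Z \<omega>)\<^sup>2 / e" using e by (simp add: field_simps power2_eq_square)
      then show ?thesis using e by linarith
    qed
  qed (use int in auto)
  also have "\<dots> = e + expectation (\<lambda>\<omega>. (Z \<omega>)\<^sup>2) / e"
    using int by (simp add: prob_space)
  also have "\<dots> \<le> e + b / e" using le e by (simp add: divide_right_mono)
  finally show ?thesis .
qed

text \<open>For factors in [0, 1] the difference of two products is at most the sum of the
  differences of the factors, and each of these is both bounded and Lipschitz.\<close>

lemma near_integral_tendsto_prob:
  fixes Z :: "nat \<Rightarrow> 'i \<Rightarrow> 'a \<Rightarrow> 'b::{second_countable_topology, metric_space}"
  assumes J: "finite J"
    and Z [measurable]: "\<And>m i. i \<in> J \<Longrightarrow> Z m i \<in> borel_measurable M"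
    and Y [measurable]: "\<And>i. i \<in> J \<Longrightarrow> Y i \<in> borel_measurable M"
    and lim: "\<And>i. i \<in> J \<Longrightarrow> tendsto_prob M (\<lambda>m. Z m i) (Y i)"
  shows "(\<lambda>m. expectation (\<lambda>\<omega>. \<Prod>i\<in>J. near k (A i) (Z m i \<omega>)))
    \<longlonglongrightarrow> expectation (\<lambda>\<omega>. \<Prod>i\<in>J. near k (A i) (Y i \<omega>))" (is "?E \<longlonglongrightarrow> ?F")
proof -
  have int: "integrable M (\<lambda>\<omega>. \<Prod>i\<in>J. near k (A i) (V i \<omega>))"
    if "\<And>i. i \<in> J \<Longrightarrow> V i \<in> borel_measurable M" for V
    using that by (intro integrable_const_bound[where B=1] borel_measurable_prod measurable_compose[OF _ borel_measurable_near])
      (auto simp: abs_prod near_bounds intro!: prod_le_1)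
  let ?G = "\<lambda>m. \<Sum>i\<in>J. (real k + 1) * expectation (\<lambda>\<omega>. min 1 (dist (Z m i \<omega>) (Y i \<omega>)))"
  have "?G \<longlonglongrightarrow> (\<Sum>i\<in>J. (real k + 1) * 0)"
    by (intro tendsto_sum tendsto_mult tendsto_const lim[unfolded tendsto_prob_def])
  then have G: "?G \<longlonglongrightarrow> 0" by simp
  have "\<bar>?E m - ?F\<bar> \<le> ?G m" for m
  proof -
    have "\<bar>?E m - ?F\<bar> = \<bar>expectation (\<lambda>\<omega>. (\<Prod>i\<in>J. near k (A i) (Z m i \<omega>)) - (\<Prod>i\<in>J. near k (A i) (Y i \<omega>)))\<bar>"
      using int[of "Z m"] int[of Y] Z Y by simp
    also have "\<dots> \<le> expectation (\<lambda>\<omega>. \<bar>(\<Prod>i\<in>J. near k (A i) (Z m i \<omega>)) - (\<Prod>i\<in>J. near k (A i) (Y i \<omega>))\<bar>)"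
      by (rule integral_abs_bound)
    also have "\<dots> \<le> expectation (\<lambda>\<omega>. \<Sum>i\<in>J. (real k + 1) * min 1 (dist (Z m i \<omega>) (Y i \<omega>)))"
    proof (rule integral_mono)
      show "integrable M (\<lambda>\<omega>. \<bar>(\<Prod>i\<in>J. near k (A i) (Z m i \<omega>)) - (\<Prod>i\<in>J. near k (A i) (Y i \<omega>))\<bar>)"
        using int[of "Z m"] int[of Y] Z Y by auto
      show "integrable M (\<lambda>\<omega>. \<Sum>i\<in>J. (real k + 1) * min 1 (dist (Z m i \<omega>) (Y i \<omega>)))"
        by (intro Bochner_Integration.integrable_sum integrable_mult_right integrable_min_1) auto
      fix \<omega>
      have "\<bar>(\<Prod>i\<in>J. near k (A i) (Z m i \<omega>)) - (\<Prod>i\<in>J. near k (A i) (Y i \<omega>))\<bar>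
          \<le> (\<Sum>i\<in>J. \<bar>near k (A i) (Z m i \<omega>) - near k (A i) (Y i \<omega>)\<bar>)"
        using norm_prod_diff[of J "\<lambda>i. near k (A i) (Z m i \<omega>)" "\<lambda>i. near k (A i) (Y i \<omega>)"]
        by (simp add: near_bounds)
      also have "\<dots> \<le> (\<Sum>i\<in>J. (real k + 1) * min 1 (dist (Z m i \<omega>) (Y i \<omega>)))"
      proof (rule sum_mono)
        fix i
        let ?D = "\<bar>near k (A i) (Z m i \<omega>) - near k (A i) (Y i \<omega>)\<bar>" and ?d = "dist (Z m i \<omega>) (Y i \<omega>)"
        have "?D \<le> 1" using near_bounds[of k "A i" "Z m i \<omega>"] near_bounds[of k "A i" "Y i \<omega>"] by linarith
        moreover have "?D \<le> real k * ?d" by (rule near_lipschitz)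
        \<comment> \<open>The constant k + 1 serves both cases: it exceeds the Lipschitz constant k
          when ?d \<le> 1, and the bound 1 otherwise.\<close>
        ultimately show "?D \<le> (real k + 1) * min 1 ?d"
          by (cases "?d \<le> 1") (auto simp: algebra_simps intro: order_trans[of _ "real k * ?d"])
      qed
      finally show "\<bar>(\<Prod>i\<in>J. near k (A i) (Z m i \<omega>)) - (\<Prod>i\<in>J. near k (A i) (Y i \<omega>))\<bar>
          \<le> (\<Sum>i\<in>J. (real k + 1) * min 1 (dist (Z m i \<omega>) (Y i \<omega>)))" .
    qed
    also have "\<dots> = ?G m"
      by (subst Bochner_Integration.integral_sum) (auto intro!: integrable_mult_right integrable_min_1)
    finally show ?thesis .
  qed
  then have "(\<lambda>m. ?E m - ?F) \<longlonglongrightarrow> 0"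
    by (intro Lim_null_comparison[OF _ G] always_eventually) auto
  then show ?thesis by (rule LIM_zero_cancel)
qed

end

section \<open>Discretized Wiener processes\<close>

lemma (in prob_space) expectation_min_1_le_abs:
  fixes Z :: "'a \<Rightarrow> real"
  assumes [measurable]: "Z \<in> borel_measurable M"
    and q: "(\<integral>\<^sup>+\<omega>. ennreal \<bar>Z \<omega>\<bar> \<partial>M) \<le> ennreal b" and b: "0 \<le> b"
  shows "expectation (\<lambda>\<omega>. min 1 \<bar>Z \<omega>\<bar>) \<le> b"
proof -
  have int: "integrable M (\<lambda>\<omega>. \<bar>Z \<omega>\<bar>)"
    using q by (intro integrableI_nonneg) (auto simp: le_less_trans[OF _ ennreal_less_top])
  have "expectation (\<lambda>\<omega>. min 1 \<bar>Z \<omega>\<bar>) \<le> expectation (\<lambda>\<omega>. \<bar>Z \<omega>\<bar>)"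
    using int by (intro integral_mono) auto
  also have "ennreal (expectation (\<lambda>\<omega>. \<bar>Z \<omega>\<bar>)) \<le> ennreal b"
    using q nn_integral_eq_integral[OF int] by simp
  then have "expectation (\<lambda>\<omega>. \<bar>Z \<omega>\<bar>) \<le> b" using b by simp
  finally show ?thesis .
qed

text \<open>What the argument uses of a Wiener process: the joint law of its increments on
  equidistant grids, and continuous paths from 0. Completeness is included since running maxima and
  path integrals are reached as almost sure limits.\<close>

locale discretized_wiener = prob_space M + complete_measure M for M :: "'a measure" +
  fixes W :: "real \<Rightarrow> 'a \<Rightarrow> real"
  assumes borel_measurable_W: "0 \<le> t \<Longrightarrow> W t \<in> borel_measurable M"
    and good_paths: "AE \<omega> in M. W 0 \<omega> = 0 \<and> continuous_on {0..} (\<lambda>t. W t \<omega>)"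
    and increments_law: "distr M (PiM {..<n} (\<lambda>_. borel)) (\<lambda>\<omega>. \<lambda>j\<in>{..<n}. incr m (\<lambda>t. W t \<omega>) j)
      = walk n (step m)"
begin

definition xi :: "nat \<Rightarrow> 'a \<Rightarrow> nat \<Rightarrow> real" where
  "xi m \<omega> = incr m (\<lambda>t. W t \<omega>)"

lemma borel_measurable_xi: "(\<lambda>\<omega>. xi m \<omega> j) \<in> borel_measurable M"
  unfolding xi_def incr_def by (intro borel_measurable_diff borel_measurable_W) auto

lemma borel_measurable_psum_xi: "(\<lambda>\<omega>. psum (xi m \<omega>) j) \<in> borel_measurable M"
  unfolding psum_def by (intro borel_measurable_sum borel_measurable_xi)

lemma borel_measurable_flip_xi: "(\<lambda>\<omega>. flip (xi m \<omega>) j) \<in> borel_measurable M"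
  unfolding flip_def
  by (intro borel_measurable_times borel_measurable_uminus borel_measurable_xi
      measurable_compose[OF borel_measurable_psum_xi measurable_sg])

lemma borel_measurable_psum_flip_xi: "(\<lambda>\<omega>. psum (flip (xi m \<omega>)) j) \<in> borel_measurable M"
  unfolding psum_def by (intro borel_measurable_sum borel_measurable_flip_xi)

lemma borel_measurable_pmax:
  assumes "\<And>j. (\<lambda>\<omega>. psum (x \<omega>) j) \<in> borel_measurable N"
  shows "(\<lambda>\<omega>. pmax (x \<omega>) n) \<in> borel_measurable N"
proof (induction n)
  case (Suc n)
  then show ?case unfolding pmax.simps by (intro borel_measurable_max assms)
qed simp

lemma borel_measurable_walk_ltime_xi: "(\<lambda>\<omega>. walk_ltime (xi m \<omega>) n) \<in> borel_measurable M"
  unfolding walk_ltime_def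
  by (intro borel_measurable_add borel_measurable_abs borel_measurable_psum_xi borel_measurable_psum_flip_xi)

lemmas xi_measurable = borel_measurable_xi borel_measurable_psum_xi borel_measurable_psum_flip_xi
  borel_measurable_walk_ltime_xi borel_measurable_pmax[OF borel_measurable_psum_xi]
  borel_measurable_pmax[OF borel_measurable_psum_flip_xi]

lemma nn_integral_xi:
  assumes "f \<in> borel_measurable (PiM {..<n} (\<lambda>_. borel))"
  shows "(\<integral>\<^sup>+\<omega>. f (\<lambda>j\<in>{..<n}. xi m \<omega> j) \<partial>M) = (\<integral>\<^sup>+x. f x \<partial>walk n (step m))"
  unfolding increments_law[symmetric] xi_def[symmetric] using assms
  by (subst nn_integral_distr) (auto intro!: measurable_restrict borel_measurable_xi)

lemma nn_integral_xi_component: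
  assumes [measurable]: "g \<in> borel_measurable borel"
  shows "(\<integral>\<^sup>+\<omega>. g (xi m \<omega> j) \<partial>M) = (\<integral>\<^sup>+y. g y \<partial>gauss (step m))"
proof -
  have f: "(\<lambda>x. g (x j)) \<in> borel_measurable (PiM {..<Suc j} (\<lambda>_. borel))"
    by (intro measurable_compose[OF measurable_walk_component]) auto
  interpret w: prob_space "walk j (step m)"
    unfolding walk_def by (intro prob_space_PiM prob_space_gauss) simp
  have "(\<integral>\<^sup>+\<omega>. g (xi m \<omega> j) \<partial>M) = (\<integral>\<^sup>+x. g (x j) \<partial>walk (Suc j) (step m))"
    using nn_integral_xi[OF f, of m] by simp
  also have "\<dots> = (\<integral>\<^sup>+y. g y \<partial>gauss (step m))"
    by (subst nn_integral_walk_Suc[OF f]) (simp_all add: w.emeasure_space_1)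
  finally show ?thesis .
qed

lemma nn_integral_xi_square:
  fixes c u :: "real \<Rightarrow> real"
  assumes c: "c \<in> borel_measurable borel" and u: "u \<in> borel_measurable borel"
    and u1: "has_bochner_integral (gauss (step m)) u 0"
    and u2: "has_bochner_integral (gauss (step m)) (\<lambda>y. (u y)\<^sup>2) v"
  shows "(\<integral>\<^sup>+\<omega>. ennreal ((\<Sum>j<n. c (psum (xi m \<omega>) j) * u (xi m \<omega> j))\<^sup>2) \<partial>M)
    = (\<integral>\<^sup>+\<omega>. ennreal (\<Sum>j<n. v * (c (psum (xi m \<omega>) j))\<^sup>2) \<partial>M)"
proof -
  have r: "psum (\<lambda>j\<in>{..<n}. x j) j = psum x j" if "j \<le> n" for x j
    using that by (intro psum_cong) auto
  have m1: "(\<lambda>x. ennreal ((\<Sum>j<n. c (psum x j) * u (x j))\<^sup>2)) \<in> borel_measurable (PiM {..<n} (\<lambda>_. borel))"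
    by (intro measurable_compose[OF measurable_walk_sum[OF c u, of n n]]) auto
  have m2: "(\<lambda>x. ennreal (\<Sum>j<n. v * (c (psum x j))\<^sup>2)) \<in> borel_measurable (PiM {..<n} (\<lambda>_. borel))"
    using measurable_walk_sum[of "\<lambda>z. v * (c z)\<^sup>2" "\<lambda>_. 1" n n] c by simp
  have "(\<integral>\<^sup>+\<omega>. ennreal ((\<Sum>j<n. c (psum (xi m \<omega>) j) * u (xi m \<omega> j))\<^sup>2) \<partial>M)
      = (\<integral>\<^sup>+x. ennreal ((\<Sum>j<n. c (psum x j) * u (x j))\<^sup>2) \<partial>walk n (step m))"
    unfolding nn_integral_xi[OF m1, symmetric] by (simp add: r)
  also have "\<dots> = (\<integral>\<^sup>+x. ennreal (\<Sum>j<n. v * (c (psum x j))\<^sup>2) \<partial>walk n (step m))"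
    by (rule nn_integral_walk_square[OF _ c u u1 u2]) simp
  also have "\<dots> = (\<integral>\<^sup>+\<omega>. ennreal (\<Sum>j<n. v * (c (psum (xi m \<omega>) j))\<^sup>2) \<partial>M)"
    unfolding nn_integral_xi[OF m2, symmetric] by (simp add: r)
  finally show ?thesis .
qed

section \<open>Bounds for the error terms of the discrete Tanaka formula\<close>

text \<open>With d = \<open>step m\<close>, the centred squares have variance 3 d^2 - 2 d^2 + d^2 =
  2 d^2. The squared weights are at most 1/e^2, and there are at most t/d summands.\<close>

lemma quadratic_variation_bound:
  assumes e: "0 < e" and t: "0 \<le> t"
  shows "(\<integral>\<^sup>+\<omega>. ennreal ((\<Sum>j<cnt m t. bump e (psum (xi m \<omega>) j) * ((xi m \<omega> j)\<^sup>2 - step m))\<^sup>2) \<partial>M)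
    \<le> ennreal (2 * t / e\<^sup>2 * step m)"
proof -
  interpret g: prob_space "gauss (step m)" by (rule prob_space_gauss) simp
  let ?d = "step m" and ?u = "\<lambda>y. y\<^sup>2 - step m"
  have const: "has_bochner_integral (gauss ?d) (\<lambda>_. b) b" for b :: real
    by (auto simp: has_bochner_integral_iff g.prob_space[simplified])
  have u1: "has_bochner_integral (gauss ?d) ?u 0"
    using has_bochner_integral_diff[OF gauss_moment_2[of ?d] const[of ?d]] by simp
  have "has_bochner_integral (gauss ?d) (\<lambda>y. y ^ 4 - 2 * ?d * y\<^sup>2 + ?d\<^sup>2) (3 * ?d\<^sup>2 - 2 * ?d * ?d + ?d\<^sup>2)"
    by (intro has_bochner_integral_add has_bochner_integral_diff has_bochner_integral_mult_right
        gauss_moment_4 gauss_moment_2 const) auto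
  then have u2: "has_bochner_integral (gauss ?d) (\<lambda>y. (?u y)\<^sup>2) (2 * ?d\<^sup>2)"
    by (simp add: power2_diff power2_eq_square power4_eq_xxxx algebra_simps)
  have "(\<Sum>j<cnt m t. 2 * ?d\<^sup>2 * (bump e (psum (xi m \<omega>) j))\<^sup>2) \<le> 2 * t / e\<^sup>2 * ?d" for \<omega>
  proof -
    have "(\<Sum>j<cnt m t. 2 * ?d\<^sup>2 * (bump e (psum (xi m \<omega>) j))\<^sup>2) \<le> (\<Sum>j<cnt m t. 2 * ?d\<^sup>2 * (1 / e)\<^sup>2)"
      using bump_nonneg[OF e] bump_le[OF e] by (intro sum_mono mult_left_mono power_mono) auto
    also have "\<dots> = (real (cnt m t) * ?d) * (2 / e\<^sup>2 * ?d)"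
      by (simp add: power2_eq_square)
    also have "\<dots> \<le> t * (2 / e\<^sup>2 * ?d)"
      using cnt_le[OF t] by (intro mult_right_mono) auto
    finally show ?thesis by (simp add: mult_ac)
  qed
  then have "(\<integral>\<^sup>+\<omega>. ennreal (\<Sum>j<cnt m t. 2 * ?d\<^sup>2 * (bump e (psum (xi m \<omega>) j))\<^sup>2) \<partial>M)
      \<le> (\<integral>\<^sup>+\<omega>. ennreal (2 * t / e\<^sup>2 * ?d) \<partial>M)"
    by (intro nn_integral_mono ennreal_leI)
  then show ?thesis
    by (subst nn_integral_xi_square[OF _ _ u1 u2]) (auto simp: emeasure_space_1)
qed

text \<open>With d = \<open>step m\<close>, there are at most t/d summands, each of mean at most 2 *
  d^(3/2) once the factor sqrt (2/pi) is bounded by 1.\<close>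

lemma cubic_variation_bound:
  assumes t: "0 \<le> t"
  shows "(\<integral>\<^sup>+\<omega>. ennreal (\<Sum>j<cnt m t. \<bar>xi m \<omega> j\<bar> ^ 3) \<partial>M) \<le> ennreal (2 * t * sqrt (step m))"
proof -
  let ?d = "step m"
  have "(\<integral>\<^sup>+\<omega>. ennreal (\<bar>xi m \<omega> j\<bar> ^ 3) \<partial>M) = ennreal (2 * sqrt ?d ^ 3 * sqrt (2 / pi))" for j
    by (subst nn_integral_xi_component[of "\<lambda>y. ennreal (\<bar>y\<bar> ^ 3)"])
       (use gauss_abs_moment_3[of ?d] in \<open>auto simp: has_bochner_integral_iff nn_integral_eq_integral\<close>)
  also have "ennreal (2 * sqrt ?d ^ 3 * sqrt (2 / pi)) \<le> ennreal (2 * sqrt ?d * ?d)"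
  proof (rule ennreal_leI)
    have "2 * sqrt ?d ^ 3 * sqrt (2 / pi) \<le> 2 * sqrt ?d ^ 3 * 1"
      using pi_ge_two by (intro mult_left_mono) (auto simp: real_sqrt_divide)
    also have "\<dots> = 2 * sqrt ?d * ?d"
      using step_pos(2)[of m] by (simp add: power3_eq_cube del: step_pos)
    finally show "2 * sqrt ?d ^ 3 * sqrt (2 / pi) \<le> 2 * sqrt ?d * ?d" .
  qed
  finally have one: "(\<integral>\<^sup>+\<omega>. ennreal (\<bar>xi m \<omega> j\<bar> ^ 3) \<partial>M) \<le> ennreal (2 * sqrt ?d * ?d)" for j .
  have "(\<integral>\<^sup>+\<omega>. ennreal (\<Sum>j<cnt m t. \<bar>xi m \<omega> j\<bar> ^ 3) \<partial>M)
      = (\<Sum>j<cnt m t. \<integral>\<^sup>+\<omega>. ennreal (\<bar>xi m \<omega> j\<bar> ^ 3) \<partial>M)"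
    by (subst nn_integral_sum[symmetric])
       (auto intro!: measurable_compose[OF borel_measurable_xi] simp: sum_ennreal)
  also have "\<dots> \<le> (\<Sum>j<cnt m t. ennreal (2 * sqrt ?d * ?d))"
    by (intro sum_mono one)
  also have "\<dots> = ennreal ((real (cnt m t) * ?d) * (2 * sqrt ?d))"
    by (simp add: ennreal_mult[symmetric] ennreal_of_nat_eq_real_of_nat mult_ac)
  also have "\<dots> \<le> ennreal (t * (2 * sqrt ?d))"
    using cnt_le[OF t] by (intro ennreal_leI mult_right_mono) auto
  finally show ?thesis by (simp add: mult_ac)
qed

lemma riemann_xi_tendsto:
  assumes g: "\<And>x. isCont g x" and t: "0 \<le> t"
  shows "AE \<omega> in M. (\<lambda>m. \<Sum>j<cnt m t. g (psum (xi m \<omega>) j) * step m)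
    \<longlonglongrightarrow> integral {0..t} (\<lambda>s. g (W s \<omega>) :: real)"
  using good_paths
proof eventually_elim
  case (elim \<omega>)
  then have "W 0 \<omega> = 0" and path: "continuous_on {0..} (\<lambda>t. W t \<omega>)" by auto
  then have X: "psum (xi m \<omega>) j = W (real j * step m) \<omega>" for m j
    by (simp add: xi_def psum_incr)
  have "continuous_on UNIV g"
    by (intro continuous_at_imp_continuous_on ballI g)
  then have "continuous_on {0..} (\<lambda>s. g (W s \<omega>))"
    by (rule continuous_on_compose2[OF _ path]) simp
  from riemann_tendsto[OF this t] show ?case
    unfolding X .
qed

lemma borel_measurable_riemann_xi:
  assumes "g \<in> borel_measurable borel"
  shows "(\<lambda>\<omega>. \<Sum>j<n. g (psum (xi m \<omega>) j) * c :: real) \<in> borel_measurable M"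
  by (intro borel_measurable_sum borel_measurable_times borel_measurable_const
      measurable_compose[OF borel_measurable_psum_xi assms])

text \<open>\<open>W\<close> is known to be measurable at each fixed time, not jointly in time and
  \<omega>; the integral is reached instead as an almost sure limit of Riemann sums.\<close>

lemma borel_measurable_path_integral:
  assumes g: "\<And>x. isCont g x" and t: "0 \<le> t"
  shows "(\<lambda>\<omega>. integral {0..t} (\<lambda>s. g (W s \<omega>) :: real)) \<in> borel_measurable M"
proof (rule borel_measurable_AE_limit[OF borel_measurable_riemann_xi riemann_xi_tendsto[OF g t]])
  show "g \<in> borel_measurable borel"
    using g by (intro borel_measurable_continuous_onI) (simp add: continuous_on_eq_continuous_at)
qed

lemma expectation_hat_riemann_tendsto:
  assumes e: "0 < e" and t: "0 \<le> t"
  shows "(\<lambda>m. expectation (\<lambda>\<omega>. \<Sum>j<cnt m t. hat e (psum (xi m \<omega>) j) * step m))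
    \<longlonglongrightarrow> expectation (\<lambda>\<omega>. integral {0..t} (\<lambda>s. hat e (W s \<omega>)))"
proof (rule integral_dominated_convergence[where w="\<lambda>_. t"])
  show "AE \<omega> in M. (\<lambda>m. \<Sum>j<cnt m t. hat e (psum (xi m \<omega>) j) * step m)
      \<longlonglongrightarrow> integral {0..t} (\<lambda>s. hat e (W s \<omega>))"
    by (rule riemann_xi_tendsto[OF isCont_hat[OF e] t])
  have "(\<Sum>j<cnt m t. hat e (psum (xi m \<omega>) j) * step m) \<le> t" for m \<omega>
  proof -
    have "(\<Sum>j<cnt m t. hat e (psum (xi m \<omega>) j) * step m) \<le> (\<Sum>j<cnt m t. 1 * step m)"
      by (intro sum_mono mult_right_mono hat_le_1) auto
    then show ?thesis using cnt_le[OF t, of m] by simp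
  qed
  then show "AE \<omega> in M. norm (\<Sum>j<cnt m t. hat e (psum (xi m \<omega>) j) * step m) \<le> t" for m
    by (intro AE_I2) (simp add: sum_nonneg hat_nonneg)
qed (auto intro!: borel_measurable_riemann_xi borel_measurable_path_integral isCont_hat e t)

text \<open>A discrete Ito isometry: the increments have variance \<open>step m\<close>, so the
  second moment is that of a Riemann sum of the squared sign error, which \<open>hat\<close>
  dominates.\<close>

lemma sign_approximation_bound:
  assumes e: "0 < e" and t: "0 \<le> t"
  shows "(\<integral>\<^sup>+\<omega>. ennreal ((\<Sum>j<cnt m t. (sg (psum (xi m \<omega>) j) - smooth_sg e (psum (xi m \<omega>) j)) * xi m \<omega> j)\<^sup>2) \<partial>M)
    \<le> ennreal (expectation (\<lambda>\<omega>. \<Sum>j<cnt m t. hat e (psum (xi m \<omega>) j) * step m))"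
proof -
  have sm: "smooth_sg e \<in> borel_measurable borel"
    unfolding smooth_sg_def smooth_abs_def by measurable
  have int: "integrable M (\<lambda>\<omega>. \<Sum>j<cnt m t. hat e (psum (xi m \<omega>) j) * step m)"
  proof (rule integrable_const_bound[where B="real (cnt m t) * step m"])
    show "AE \<omega> in M. norm (\<Sum>j<cnt m t. hat e (psum (xi m \<omega>) j) * step m) \<le> real (cnt m t) * step m"
    proof (rule AE_I2)
      fix \<omega>
      have "(\<Sum>j<cnt m t. hat e (psum (xi m \<omega>) j) * step m) \<le> (\<Sum>j<cnt m t. 1 * step m)"
        by (intro sum_mono mult_right_mono hat_le_1) auto
      then show "norm (\<Sum>j<cnt m t. hat e (psum (xi m \<omega>) j) * step m) \<le> real (cnt m t) * step m"
        by (simp add: sum_nonneg hat_nonneg)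
    qed
  qed (rule borel_measurable_riemann_xi, measurable)
  have "(\<integral>\<^sup>+\<omega>. ennreal ((\<Sum>j<cnt m t. (sg (psum (xi m \<omega>) j) - smooth_sg e (psum (xi m \<omega>) j)) * xi m \<omega> j)\<^sup>2) \<partial>M)
     = (\<integral>\<^sup>+\<omega>. ennreal (\<Sum>j<cnt m t. step m * (sg (psum (xi m \<omega>) j) - smooth_sg e (psum (xi m \<omega>) j))\<^sup>2) \<partial>M)"
    using sm by (intro nn_integral_xi_square gauss_moment_1 gauss_moment_2) auto
  also have "\<dots> \<le> (\<integral>\<^sup>+\<omega>. ennreal (\<Sum>j<cnt m t. hat e (psum (xi m \<omega>) j) * step m) \<partial>M)"
  proof (intro nn_integral_mono ennreal_leI sum_mono)
    fix \<omega> j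
    show "step m * (sg (psum (xi m \<omega>) j) - smooth_sg e (psum (xi m \<omega>) j))\<^sup>2 \<le> hat e (psum (xi m \<omega>) j) * step m"
      by (subst mult.commute) (intro mult_right_mono sg_diff_le_hat[OF e], simp)
  qed
  also have "\<dots> = ennreal (expectation (\<lambda>\<omega>. \<Sum>j<cnt m t. hat e (psum (xi m \<omega>) j) * step m))"
    using int by (intro nn_integral_eq_integral) (auto intro!: AE_I2 sum_nonneg simp: hat_nonneg)
  finally show ?thesis .
qed

end

section \<open>Convergence of the discrete local time\<close>

lemma min_1_le_sum:
  fixes x e a b c p q :: real
  assumes "x \<le> e + a + b + c + p + q" "0 \<le> e" "0 \<le> a" "0 \<le> b" "0 \<le> c" "0 \<le> p" "0 \<le> q"
  shows "min 1 x \<le> e + min 1 a + min 1 b + min 1 c + min 1 p + min 1 q"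
  using assms unfolding min_def by (simp split: if_split)

context discretized_wiener
begin

lemma walk_ltime_xi_tendsto_prob:
  assumes t: "0 \<le> t" and L [measurable]: "L \<in> borel_measurable M"
    and hat_lim: "AE \<omega> in M. (\<lambda>n. integral {0..t} (\<lambda>s. hat (step n) (W s \<omega>))) \<longlonglongrightarrow> 0"
    and bump_lim: "AE \<omega> in M. (\<lambda>n. integral {0..t} (\<lambda>s. bump (step n) (W s \<omega>)) / 2) \<longlonglongrightarrow> L \<omega>"
  shows "tendsto_prob M (\<lambda>m \<omega>. walk_ltime (xi m \<omega>) (cnt m t)) L"
  unfolding tendsto_prob_def
proof (rule LIMSEQ_I)
  fix r :: real assume r: "0 < r"
  \<comment> \<open>The budget is \<eta> each for the width e, for C, for R against I and for I
    against L, and 2 * \<eta> each for A and B, whose bounds come from second moments.\<close>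
  define \<eta> where "\<eta> = r / 8"
  have \<eta>: "0 < \<eta>" using r by (simp add: \<eta>_def)
  have hat_m: "(\<lambda>\<omega>. integral {0..t} (\<lambda>s. hat (step n) (W s \<omega>))) \<in> borel_measurable M" for n
    by (intro borel_measurable_path_integral isCont_hat t) simp
  have bump_m [measurable]: "(\<lambda>\<omega>. integral {0..t} (\<lambda>s. bump (step n) (W s \<omega>))) \<in> borel_measurable M" for n
    by (intro borel_measurable_path_integral isCont_bump t) simp
  have hat_E: "(\<lambda>n. expectation (\<lambda>\<omega>. integral {0..t} (\<lambda>s. hat (step n) (W s \<omega>)))) \<longlonglongrightarrow> expectation (\<lambda>_. 0)"
  proof (rule integral_dominated_convergence[where w="\<lambda>_. t"])
    show "AE \<omega> in M. norm (integral {0..t} (\<lambda>s. hat (step n) (W s \<omega>))) \<le> t" for n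
      using good_paths
    proof eventually_elim
      case (elim \<omega>)
      have "continuous_on UNIV (hat (step n))"
        by (intro continuous_at_imp_continuous_on ballI isCont_hat) simp
      then have "continuous_on {0..} (\<lambda>s. hat (step n) (W s \<omega>))"
        by (rule continuous_on_compose2[OF _ conjunct2[OF elim]]) simp
      then have "continuous_on {0..t} (\<lambda>s. hat (step n) (W s \<omega>))"
        by (rule continuous_on_subset) auto
      then have "norm (integral {0..t} (\<lambda>s. hat (step n) (W s \<omega>))) \<le> 1 * (t - 0)"
        by (intro integral_bound t) (auto simp: hat_nonneg hat_le_1)
      then show ?case by simp
    qed
  qed (auto intro: hat_m hat_lim)
  then have hat_E: "(\<lambda>n. expectation (\<lambda>\<omega>. integral {0..t} (\<lambda>s. hat (step n) (W s \<omega>)))) \<longlonglongrightarrow> 0"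
    by simp
  have bump_E: "(\<lambda>n. expectation (\<lambda>\<omega>. min 1 (dist (integral {0..t} (\<lambda>s. bump (step n) (W s \<omega>)) / 2) (L \<omega>)))) \<longlonglongrightarrow> 0"
    using AE_tendsto_prob[OF _ L bump_lim] by (simp add: tendsto_prob_def)
  have "\<forall>\<^sub>F n in sequentially. step n < \<eta> \<and>
      expectation (\<lambda>\<omega>. integral {0..t} (\<lambda>s. hat (step n) (W s \<omega>))) < \<eta>\<^sup>2 \<and>
      expectation (\<lambda>\<omega>. min 1 (dist (integral {0..t} (\<lambda>s. bump (step n) (W s \<omega>)) / 2) (L \<omega>))) < \<eta>"
    using \<eta> by (intro eventually_conj order_tendstoD(2)[OF step_tendsto_0] order_tendstoD(2)[OF hat_E]
        order_tendstoD(2)[OF bump_E]) auto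
  then obtain n where n: "step n < \<eta>"
      "expectation (\<lambda>\<omega>. integral {0..t} (\<lambda>s. hat (step n) (W s \<omega>))) < \<eta>\<^sup>2"
      "expectation (\<lambda>\<omega>. min 1 (dist (integral {0..t} (\<lambda>s. bump (step n) (W s \<omega>)) / 2) (L \<omega>))) < \<eta>"
    unfolding eventually_sequentially by blast
  \<comment> \<open>From here on e is fixed, and only the mesh index m moves.\<close>
  define e where "e = step n"
  have e: "0 < e" by (simp add: e_def)
  define A where "A m \<omega> = (\<Sum>j<cnt m t. (sg (psum (xi m \<omega>) j) - smooth_sg e (psum (xi m \<omega>) j)) * xi m \<omega> j)" for m \<omega>
  define B where "B m \<omega> = (\<Sum>j<cnt m t. bump e (psum (xi m \<omega>) j) * ((xi m \<omega> j)\<^sup>2 - step m))" for m \<omega>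
  define C where "C m \<omega> = 3 / e\<^sup>2 * (\<Sum>j<cnt m t. \<bar>xi m \<omega> j\<bar> ^ 3)" for m \<omega>
  define R where "R m \<omega> = (\<Sum>j<cnt m t. bump e (psum (xi m \<omega>) j) * step m) / 2" for m \<omega>
  define I where "I \<omega> = integral {0..t} (\<lambda>s. bump e (W s \<omega>)) / 2" for \<omega>
  have sm: "smooth_sg e \<in> borel_measurable borel"
    unfolding smooth_sg_def smooth_abs_def by measurable
  have [measurable]: "A m \<in> borel_measurable M" for m
    unfolding A_def using sm
    by (intro borel_measurable_sum borel_measurable_times borel_measurable_diff borel_measurable_xi
        measurable_compose[OF borel_measurable_psum_xi]) auto
  have [measurable]: "B m \<in> borel_measurable M" for m
    unfolding B_def
    by (intro borel_measurable_sum borel_measurable_times borel_measurable_diff borel_measurable_power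
        borel_measurable_xi borel_measurable_const measurable_compose[OF borel_measurable_psum_xi]) auto
  have [measurable]: "C m \<in> borel_measurable M" for m
    unfolding C_def
    by (intro borel_measurable_sum borel_measurable_times borel_measurable_power borel_measurable_abs
        borel_measurable_xi borel_measurable_const)
  have [measurable]: "R m \<in> borel_measurable M" for m
    unfolding R_def by (intro borel_measurable_divide borel_measurable_riemann_xi) auto
  have [measurable]: "I \<in> borel_measurable M"
    unfolding I_def e_def by measurable
  have [measurable]: "(\<lambda>\<omega>. walk_ltime (xi m \<omega>) (cnt m t)) \<in> borel_measurable M" for m
    by (rule borel_measurable_walk_ltime_xi)
  \<comment> \<open>The bounds for B and C vanish with the mesh, but the one for A tends to the
    expected integral of \<open>hat e\<close>; it is small because of the choice of n.\<close>
  have EA: "\<forall>\<^sub>F m in sequentially. expectation (\<lambda>\<omega>. min 1 \<bar>A m \<omega>\<bar>) \<le> 2 * \<eta>"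
    using order_tendstoD(2)[OF expectation_hat_riemann_tendsto[OF e t] n(2)[folded e_def]]
  proof eventually_elim
    case (elim m)
    have "(\<integral>\<^sup>+\<omega>. ennreal ((A m \<omega>)\<^sup>2) \<partial>M) \<le> ennreal (\<eta>\<^sup>2)"
      unfolding A_def by (rule order_trans[OF sign_approximation_bound[OF e t]]) (use elim in \<open>auto intro: ennreal_leI\<close>)
    then have "expectation (\<lambda>\<omega>. min 1 \<bar>A m \<omega>\<bar>) \<le> \<eta> + \<eta>\<^sup>2 / \<eta>"
      using \<eta> by (intro expectation_min_1_le_square) auto
    then show ?case using \<eta> by (simp add: power2_eq_square)
  qed
  have "(\<lambda>m. 2 * t / e\<^sup>2 * step m) \<longlonglongrightarrow> 2 * t / e\<^sup>2 * 0"
    by (intro tendsto_intros step_tendsto_0)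
  then have "\<forall>\<^sub>F m in sequentially. 2 * t / e\<^sup>2 * step m < \<eta>\<^sup>2"
    by (rule order_tendstoD) (use \<eta> in simp)
  then have EB: "\<forall>\<^sub>F m in sequentially. expectation (\<lambda>\<omega>. min 1 \<bar>B m \<omega>\<bar>) \<le> 2 * \<eta>"
  proof eventually_elim
    case (elim m)
    have "(\<integral>\<^sup>+\<omega>. ennreal ((B m \<omega>)\<^sup>2) \<partial>M) \<le> ennreal (\<eta>\<^sup>2)"
      unfolding B_def by (rule order_trans[OF quadratic_variation_bound[OF e t]]) (use elim in \<open>auto intro: ennreal_leI\<close>)
    then have "expectation (\<lambda>\<omega>. min 1 \<bar>B m \<omega>\<bar>) \<le> \<eta> + \<eta>\<^sup>2 / \<eta>"
      using \<eta> by (intro expectation_min_1_le_square) auto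
    then show ?case using \<eta> by (simp add: power2_eq_square)
  qed
  have "(\<lambda>m. 3 / e\<^sup>2 * (2 * t * sqrt (step m))) \<longlonglongrightarrow> 3 / e\<^sup>2 * (2 * t * sqrt 0)"
    by (intro tendsto_intros step_tendsto_0)
  then have "\<forall>\<^sub>F m in sequentially. 3 / e\<^sup>2 * (2 * t * sqrt (step m)) < \<eta>"
    by (rule order_tendstoD) (use \<eta> in simp)
  then have EC: "\<forall>\<^sub>F m in sequentially. expectation (\<lambda>\<omega>. min 1 \<bar>C m \<omega>\<bar>) \<le> \<eta>"
  proof eventually_elim
    case (elim m)
    have "(\<integral>\<^sup>+\<omega>. ennreal \<bar>C m \<omega>\<bar> \<partial>M) = (\<integral>\<^sup>+\<omega>. ennreal (3 / e\<^sup>2) * ennreal (\<Sum>j<cnt m t. \<bar>xi m \<omega> j\<bar> ^ 3) \<partial>M)"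
      unfolding C_def using e
      by (intro nn_integral_cong) (auto simp: abs_mult ennreal_mult[symmetric] sum_nonneg intro!: arg_cong[where f=ennreal])
    also have "\<dots> = ennreal (3 / e\<^sup>2) * (\<integral>\<^sup>+\<omega>. ennreal (\<Sum>j<cnt m t. \<bar>xi m \<omega> j\<bar> ^ 3) \<partial>M)"
      by (intro nn_integral_cmult measurable_compose[OF _ measurable_ennreal] borel_measurable_sum
          borel_measurable_power borel_measurable_abs borel_measurable_xi)
    also have "\<dots> \<le> ennreal (3 / e\<^sup>2) * ennreal (2 * t * sqrt (step m))"
      by (intro mult_left_mono cubic_variation_bound t) simp
    also have "\<dots> = ennreal (3 / e\<^sup>2 * (2 * t * sqrt (step m)))"
      using t by (intro ennreal_mult[symmetric]) auto
    also have "\<dots> \<le> ennreal \<eta>" using elim by (intro ennreal_leI) auto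
    finally show ?case using \<eta> by (intro expectation_min_1_le_abs) auto
  qed
  have "AE \<omega> in M. (\<lambda>m. R m \<omega>) \<longlonglongrightarrow> I \<omega>"
    using riemann_xi_tendsto[OF isCont_bump[OF e] t]
    by eventually_elim (auto simp: R_def I_def intro!: tendsto_divide)
  then have "tendsto_prob M R I" by (intro AE_tendsto_prob) auto
  then have ED: "\<forall>\<^sub>F m in sequentially. expectation (\<lambda>\<omega>. min 1 (dist (R m \<omega>) (I \<omega>))) < \<eta>"
    unfolding tendsto_prob_def using \<eta> by (rule order_tendstoD(2))
  have EE: "expectation (\<lambda>\<omega>. min 1 (dist (I \<omega>) (L \<omega>))) < \<eta>"
    using n(3) by (simp add: I_def e_def)
  have "\<forall>\<^sub>F m in sequentially. expectation (\<lambda>\<omega>. min 1 (dist (walk_ltime (xi m \<omega>) (cnt m t)) (L \<omega>))) < r"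
    using EA EB EC ED
  proof eventually_elim
    case (elim m)
    have "expectation (\<lambda>\<omega>. min 1 (dist (walk_ltime (xi m \<omega>) (cnt m t)) (L \<omega>)))
      \<le> expectation (\<lambda>\<omega>. e + min 1 \<bar>A m \<omega>\<bar> + min 1 \<bar>B m \<omega>\<bar> + min 1 \<bar>C m \<omega>\<bar>
          + min 1 (dist (R m \<omega>) (I \<omega>)) + min 1 (dist (I \<omega>) (L \<omega>)))"
    proof (rule integral_mono)
      show "integrable M (\<lambda>\<omega>. e + min 1 \<bar>A m \<omega>\<bar> + min 1 \<bar>B m \<omega>\<bar> + min 1 \<bar>C m \<omega>\<bar>
          + min 1 (dist (R m \<omega>) (I \<omega>)) + min 1 (dist (I \<omega>) (L \<omega>)))"
        by (intro Bochner_Integration.integrable_add integrable_min_1) auto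
      fix \<omega>
      have "\<bar>walk_ltime (xi m \<omega>) (cnt m t) - R m \<omega>\<bar> \<le> e + \<bar>A m \<omega>\<bar> + \<bar>B m \<omega>\<bar> + C m \<omega>"
        unfolding A_def B_def C_def R_def by (rule discrete_tanaka[OF e])
      then have "dist (walk_ltime (xi m \<omega>) (cnt m t)) (L \<omega>)
          \<le> e + \<bar>A m \<omega>\<bar> + \<bar>B m \<omega>\<bar> + \<bar>C m \<omega>\<bar> + dist (R m \<omega>) (I \<omega>) + dist (I \<omega>) (L \<omega>)"
        unfolding dist_real_def by linarith
      then show "min 1 (dist (walk_ltime (xi m \<omega>) (cnt m t)) (L \<omega>))
          \<le> e + min 1 \<bar>A m \<omega>\<bar> + min 1 \<bar>B m \<omega>\<bar> + min 1 \<bar>C m \<omega>\<bar>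
          + min 1 (dist (R m \<omega>) (I \<omega>)) + min 1 (dist (I \<omega>) (L \<omega>))"
        using e by (intro min_1_le_sum) auto
    qed auto
    also have "\<dots> = e + expectation (\<lambda>\<omega>. min 1 \<bar>A m \<omega>\<bar>) + expectation (\<lambda>\<omega>. min 1 \<bar>B m \<omega>\<bar>)
        + expectation (\<lambda>\<omega>. min 1 \<bar>C m \<omega>\<bar>) + expectation (\<lambda>\<omega>. min 1 (dist (R m \<omega>) (I \<omega>)))
        + expectation (\<lambda>\<omega>. min 1 (dist (I \<omega>) (L \<omega>)))"
      by (simp add: prob_space)
    also have "\<dots> < r" using elim EE n(1) unfolding \<eta>_def e_def by linarith
    finally show ?case .
  qed
  then obtain m0 where m0: "\<And>m. m0 \<le> m \<Longrightarrow> expectation (\<lambda>\<omega>. min 1 (dist (walk_ltime (xi m \<omega>) (cnt m t)) (L \<omega>))) < r"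
    unfolding eventually_sequentially by blast
  have "0 \<le> expectation (\<lambda>\<omega>. min 1 (dist (walk_ltime (xi m \<omega>) (cnt m t)) (L \<omega>)))" for m
    by (intro Bochner_Integration.integral_nonneg) auto
  then show "\<exists>m0. \<forall>m\<ge>m0. norm (expectation (\<lambda>\<omega>. min 1 (dist (walk_ltime (xi m \<omega>) (cnt m t)) (L \<omega>))) - 0) < r"
    using m0 by auto
qed

section \<open>The two limits of the drawdown functional\<close>

text \<open>A single functional produces both sides of the theorem: evaluated at the increments of
  the walk it approximates (S - W, S), evaluated at the flipped increments it approximates (|W|,
  L).\<close>

definition drawdown :: "nat \<Rightarrow> real \<Rightarrow> (nat \<Rightarrow> real) \<Rightarrow> real \<times> real" where
  "drawdown m t x = (pmax x (cnt m t) - psum x (cnt m t), pmax x (cnt m t))"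

lemma drawdown_cong:
  assumes "\<And>i. i < cnt m t \<Longrightarrow> x i = y i" shows "drawdown m t x = drawdown m t y"
  using pmax_cong[of "cnt m t" x y] psum_cong[of "cnt m t" x y] assms by (simp add: drawdown_def)

lemma borel_measurable_drawdown:
  assumes "\<And>j. j \<le> cnt m t \<Longrightarrow> (\<lambda>\<omega>. psum (x \<omega>) j) \<in> borel_measurable N"
  shows "(\<lambda>\<omega>. drawdown m t (x \<omega>)) \<in> borel_measurable N"
proof -
  have "n \<le> cnt m t \<Longrightarrow> (\<lambda>\<omega>. pmax (x \<omega>) n) \<in> borel_measurable N" for n
  proof (induction n)
    case (Suc n)
    then show ?case unfolding pmax.simps by (intro borel_measurable_max assms) auto
  qed simp
  then show ?thesis
    unfolding drawdown_def by (intro borel_measurable_Pair borel_measurable_diff assms) auto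
qed

lemma expectation_drawdown_flip:
  assumes J: "finite J"
  shows "expectation (\<lambda>\<omega>. \<Prod>t\<in>J. near k (A t) (drawdown m t (flip (xi m \<omega>))))
    = expectation (\<lambda>\<omega>. \<Prod>t\<in>J. near k (A t) (drawdown m t (xi m \<omega>)))"
proof -
  \<comment> \<open>One length n serves all times in J, so that the whole product is a function of
    the first n increments and their joint law can be used.\<close>
  obtain n where n: "\<And>t. t \<in> J \<Longrightarrow> cnt m t \<le> n"
    using finite_nat_set_iff_bounded_le[of "cnt m ` J"] J by auto
  define f where "f x = (\<Prod>t\<in>J. near k (A t) (drawdown m t x))" for x
  have f0: "0 \<le> f x" for x by (auto simp: f_def near_bounds intro!: prod_nonneg)
  have f_cong: "f x = f y" if "\<And>i. i < n \<Longrightarrow> x i = y i" for x y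
    unfolding f_def using n that
    by (intro prod.cong refl arg_cong[where f="near k (A t)" for t] drawdown_cong) (meson order_less_le_trans)
  have fm: "(\<lambda>\<omega>. f (x \<omega>)) \<in> borel_measurable N"
    if "\<And>j. j \<le> n \<Longrightarrow> (\<lambda>\<omega>. psum (x \<omega>) j) \<in> borel_measurable N" for x N
    unfolding f_def using n that
    by (intro borel_measurable_prod measurable_compose[OF borel_measurable_drawdown borel_measurable_near])
       (meson order_trans)
  have w: "(\<lambda>x. ennreal (f x)) \<in> borel_measurable (PiM {..<n} (\<lambda>_. borel))"
    by (intro measurable_compose[OF fm measurable_ennreal]) (rule measurable_psum)
  have wf: "(\<lambda>x. ennreal (f (\<lambda>j\<in>{..<n}. flip x j))) \<in> borel_measurable (PiM {..<n} (\<lambda>_. borel))"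
    by (rule measurable_compose[OF measurable_flip_vec w])
  have "(\<integral>\<^sup>+\<omega>. ennreal (f (flip (xi m \<omega>))) \<partial>M)
      = (\<integral>\<^sup>+\<omega>. ennreal (f (\<lambda>j\<in>{..<n}. flip (\<lambda>j\<in>{..<n}. xi m \<omega> j) j)) \<partial>M)"
  proof (intro nn_integral_cong arg_cong[where f=ennreal] f_cong)
    fix \<omega> i assume "i < n"
    then show "flip (xi m \<omega>) i = (\<lambda>j\<in>{..<n}. flip (\<lambda>j\<in>{..<n}. xi m \<omega> j) j) i"
      by (auto intro!: flip_cong)
  qed
  also have "\<dots> = (\<integral>\<^sup>+x. ennreal (f x) \<partial>walk n (step m))"
    using nn_integral_xi[OF wf, of m] nn_integral_walk_flip[OF _ w, of "step m"] by simp
  also have "\<dots> = (\<integral>\<^sup>+\<omega>. ennreal (f (\<lambda>j\<in>{..<n}. xi m \<omega> j)) \<partial>M)"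
    using nn_integral_xi[OF w, of m] by simp
  also have "\<dots> = (\<integral>\<^sup>+\<omega>. ennreal (f (xi m \<omega>)) \<partial>M)"
    by (intro nn_integral_cong arg_cong[where f=ennreal] f_cong) simp
  finally have "(\<integral>\<^sup>+\<omega>. ennreal (f (flip (xi m \<omega>))) \<partial>M) = (\<integral>\<^sup>+\<omega>. ennreal (f (xi m \<omega>)) \<partial>M)" .
  then have "expectation (\<lambda>\<omega>. f (flip (xi m \<omega>))) = expectation (\<lambda>\<omega>. f (xi m \<omega>))"
    by (subst (1 2) integral_eq_nn_integral)
       (auto intro!: f0 fm borel_measurable_psum_xi borel_measurable_psum_flip_xi)
  then show ?thesis by (simp add: f_def)
qed

lemma drawdown_xi_AE_limit:
  assumes t: "0 \<le> t"
  shows "AE \<omega> in M. (\<lambda>m. pmax (xi m \<omega>) (cnt m t)) \<longlonglongrightarrow> running_max W t \<omega>"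
    and "AE \<omega> in M. (\<lambda>m. psum (xi m \<omega>) (cnt m t)) \<longlonglongrightarrow> W t \<omega>"
  using good_paths
proof (eventually_elim)
  case (elim \<omega>)
  show ?case unfolding xi_def running_max_def
    by (rule pmax_incr_tendsto) (use elim t in auto)
next
  show "AE \<omega> in M. (\<lambda>m. psum (xi m \<omega>) (cnt m t)) \<longlonglongrightarrow> W t \<omega>"
    using good_paths
  proof eventually_elim
    case (elim \<omega>)
    then show ?case
      using grid_value_tendsto[of "\<lambda>t. W t \<omega>" t] t by (simp add: xi_def psum_incr)
  qed
qed

lemma borel_measurable_running_max: "0 \<le> t \<Longrightarrow> running_max W t \<in> borel_measurable M"
  by (rule borel_measurable_AE_limit[OF xi_measurable(5) drawdown_xi_AE_limit(1)])

text \<open>The discrete Skorokhod lemma leaves an error of the size of the largest increment, which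
  tends to 0 along a continuous path.\<close>

lemma walk_ltime_pmax_flip_AE_limit:
  assumes t: "0 \<le> t"
  shows "AE \<omega> in M. (\<lambda>m. pmax (flip (xi m \<omega>)) (cnt m t) - walk_ltime (xi m \<omega>) (cnt m t)) \<longlonglongrightarrow> 0"
  using good_paths
proof eventually_elim
  case (elim \<omega>)
  show ?case
  proof (rule tendstoI)
    fix r :: real assume r: "0 < r"
    then have "\<forall>\<^sub>F m in sequentially. \<forall>j<cnt m t. \<bar>incr m (\<lambda>t. W t \<omega>) j\<bar> \<le> r / 2"
      using elim t by (intro incr_small) auto
    then show "\<forall>\<^sub>F m in sequentially. dist (pmax (flip (xi m \<omega>)) (cnt m t) - walk_ltime (xi m \<omega>) (cnt m t)) 0 < r"
    proof eventually_elim
      case (elim m)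
      have "\<bar>walk_ltime (xi m \<omega>) (cnt m t) - pmax (flip (xi m \<omega>)) (cnt m t)\<bar> \<le> r / 2"
        using elim r by (intro abs_walk_ltime_pmax_flip_le) (auto simp: xi_def)
      then show ?case using r by (simp add: abs_minus_commute)
    qed
  qed
qed

lemma tendsto_prob_Pair:
  fixes Z Z' :: "nat \<Rightarrow> 'a \<Rightarrow> real"
  assumes "tendsto_prob M Z Y" "tendsto_prob M Z' Y'"
    and [measurable]: "\<And>n. Z n \<in> borel_measurable M" "Y \<in> borel_measurable M"
      "\<And>n. Z' n \<in> borel_measurable M" "Y' \<in> borel_measurable M"
  shows "tendsto_prob M (\<lambda>n \<omega>. (Z n \<omega>, Z' n \<omega>)) (\<lambda>\<omega>. (Y \<omega>, Y' \<omega>))"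
  by (rule tendsto_prob_sandwich[OF assms(1,2)])
     (auto simp: dist_Pair_Pair intro!: borel_measurable_Pair sqrt_sum_squares_le_sum)

lemma drawdown_xi_tendsto_prob:
  assumes t: "0 \<le> t"
  shows "tendsto_prob M (\<lambda>m \<omega>. drawdown m t (xi m \<omega>)) (\<lambda>\<omega>. (running_max W t \<omega> - W t \<omega>, running_max W t \<omega>))"
  unfolding drawdown_def
proof (intro tendsto_prob_Pair AE_tendsto_prob)
  show "AE \<omega> in M. (\<lambda>m. pmax (xi m \<omega>) (cnt m t) - psum (xi m \<omega>) (cnt m t))
      \<longlonglongrightarrow> running_max W t \<omega> - W t \<omega>"
    using drawdown_xi_AE_limit[OF t] by eventually_elim (rule tendsto_diff)
  show "AE \<omega> in M. (\<lambda>m. pmax (xi m \<omega>) (cnt m t)) \<longlonglongrightarrow> running_max W t \<omega>"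
    by (rule drawdown_xi_AE_limit[OF t])
qed (auto intro!: borel_measurable_diff xi_measurable borel_measurable_running_max borel_measurable_W t)

lemma drawdown_flip_xi_tendsto_prob:
  assumes t: "0 \<le> t" and L: "L \<in> borel_measurable M"
    and walk_ltime: "tendsto_prob M (\<lambda>m \<omega>. walk_ltime (xi m \<omega>) (cnt m t)) L"
  shows "tendsto_prob M (\<lambda>m \<omega>. drawdown m t (flip (xi m \<omega>))) (\<lambda>\<omega>. (\<bar>W t \<omega>\<bar>, L \<omega>))"
  unfolding drawdown_def
proof (intro tendsto_prob_Pair)
  let ?D = "\<lambda>m \<omega>. pmax (flip (xi m \<omega>)) (cnt m t) - walk_ltime (xi m \<omega>) (cnt m t)"
  show "tendsto_prob M (\<lambda>m \<omega>. pmax (flip (xi m \<omega>)) (cnt m t) - psum (flip (xi m \<omega>)) (cnt m t)) (\<lambda>\<omega>. \<bar>W t \<omega>\<bar>)"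
  proof (rule AE_tendsto_prob)
    show "AE \<omega> in M. (\<lambda>m. pmax (flip (xi m \<omega>)) (cnt m t) - psum (flip (xi m \<omega>)) (cnt m t)) \<longlonglongrightarrow> \<bar>W t \<omega>\<bar>"
      using walk_ltime_pmax_flip_AE_limit[OF t] drawdown_xi_AE_limit(2)[OF t]
    proof eventually_elim
      case (elim \<omega>)
      \<comment> \<open>By definition \<open>walk_ltime\<close> exceeds the flipped walk by the
        absolute value of the walk, so the drawdown of the flipped walk is this absolute value plus
        the Skorokhod error.\<close>
      from tendsto_add[OF elim(1) tendsto_rabs[OF elim(2)]]
      show ?case by (simp add: walk_ltime_def)
    qed
  qed (auto intro!: borel_measurable_diff borel_measurable_abs xi_measurable borel_measurable_W t)
  have "tendsto_prob M ?D (\<lambda>_. 0)"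
    by (intro AE_tendsto_prob walk_ltime_pmax_flip_AE_limit t) (auto intro!: borel_measurable_diff xi_measurable)
  from this walk_ltime
  show "tendsto_prob M (\<lambda>m \<omega>. pmax (flip (xi m \<omega>)) (cnt m t)) L"
    by (rule tendsto_prob_sandwich)
       (auto intro!: borel_measurable_diff xi_measurable L simp: dist_real_def)
qed (auto intro!: borel_measurable_diff borel_measurable_abs xi_measurable borel_measurable_W t L)

text \<open>One sequence of expectations has two limits: computed from the walk it tends to the
  value for the left process, rewritten with the flipped walk to the value for the right
  one.\<close>

lemma levy_equal_in_law:
  assumes L: "\<And>t. 0 \<le> t \<Longrightarrow> L t \<in> borel_measurable M"
    and walk_ltime: "\<And>t. 0 \<le> t \<Longrightarrow> tendsto_prob M (\<lambda>m \<omega>. walk_ltime (xi m \<omega>) (cnt m t)) (L t)"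
  shows "equal_in_law
    M (\<lambda>t \<omega>. (running_max W t \<omega> - W t \<omega>, running_max W t \<omega>))
    M (\<lambda>t \<omega>. (\<bar>W t \<omega>\<bar>, L t \<omega>))"
proof -
  let ?X = "\<lambda>t \<omega>. (running_max W t \<omega> - W t \<omega>, running_max W t \<omega>)"
  let ?Y = "\<lambda>t \<omega>. (\<bar>W t \<omega>\<bar>, L t \<omega>)"
  have X: "?X t \<in> borel_measurable M" and Y: "?Y t \<in> borel_measurable M" if "0 \<le> t" for t
    using that
    by (auto intro!: borel_measurable_Pair borel_measurable_diff borel_measurable_abs
        borel_measurable_running_max borel_measurable_W L)
  have "distr M (PiM {0..} (\<lambda>_. borel)) (\<lambda>\<omega>. \<lambda>t\<in>{0..}. ?X t \<omega>)
      = distr M (PiM {0..} (\<lambda>_. borel)) (\<lambda>\<omega>. \<lambda>t\<in>{0..}. ?Y t \<omega>)"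
  proof (rule distr_PiM_eqI[OF prob_space_axioms prob_space_axioms])
    fix J :: "real set" and A k assume J: "finite J" "J \<subseteq> {0..}"
    show "expectation (\<lambda>\<omega>. \<Prod>t\<in>J. near k (A t) (?X t \<omega>)) = expectation (\<lambda>\<omega>. \<Prod>t\<in>J. near k (A t) (?Y t \<omega>))"
    proof (rule LIMSEQ_unique)
      show "(\<lambda>m. expectation (\<lambda>\<omega>. \<Prod>t\<in>J. near k (A t) (drawdown m t (xi m \<omega>))))
          \<longlonglongrightarrow> expectation (\<lambda>\<omega>. \<Prod>t\<in>J. near k (A t) (?X t \<omega>))"
        using J X by (intro near_integral_tendsto_prob borel_measurable_drawdown borel_measurable_psum_xi
            drawdown_xi_tendsto_prob) auto
      show "(\<lambda>m. expectation (\<lambda>\<omega>. \<Prod>t\<in>J. near k (A t) (drawdown m t (xi m \<omega>))))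
          \<longlonglongrightarrow> expectation (\<lambda>\<omega>. \<Prod>t\<in>J. near k (A t) (?Y t \<omega>))"
        unfolding expectation_drawdown_flip[OF J(1), symmetric]
        using J Y by (intro near_integral_tendsto_prob borel_measurable_drawdown borel_measurable_psum_flip_xi
            drawdown_flip_xi_tendsto_prob L walk_ltime) auto
    qed
  qed (use X Y in auto)
  then show ?thesis unfolding equal_in_law_def using X Y by auto
qed

end

section \<open>From Wiener processes to the discretized setting\<close>

lemma (in wiener_process) increments_law:
  "distr M (PiM {..<n} (\<lambda>_. borel)) (\<lambda>\<omega>. \<lambda>j\<in>{..<n}. incr m (\<lambda>t. W t \<omega>) j) = walk n (step m)"
proof (cases "n = 0")
  case True
  \<comment> \<open>The characterization of independence by product laws is applied to nonempty
    index sets only. For n = 0 both sides are probability measures on a one-point space.\<close>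
  show ?thesis
  proof (rule measure_eqI)
    fix S assume "S \<in> sets (distr M (PiM {..<n} (\<lambda>_. borel)) (\<lambda>\<omega>. \<lambda>j\<in>{..<n}. incr m (\<lambda>t. W t \<omega>) j))"
    then have S: "S \<in> sets (PiM {} (\<lambda>_. borel :: real measure))" using True by simp
    interpret w: prob_space "walk n (step m)"
      unfolding walk_def by (intro prob_space_PiM prob_space_gauss) simp
    interpret d: prob_space "distr M (PiM {..<n} (\<lambda>_. borel)) (\<lambda>\<omega>. \<lambda>j\<in>{..<n}. incr m (\<lambda>t. W t \<omega>) j)"
      unfolding True by (intro prob_space_distr measurable_restrict) simp
    from S have "S = {} \<or> S = {\<lambda>_. undefined}" by (auto simp: sets_PiM_empty)
    then show "emeasure (distr M (PiM {..<n} (\<lambda>_. borel)) (\<lambda>\<omega>. \<lambda>j\<in>{..<n}. incr m (\<lambda>t. W t \<omega>) j)) S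
        = emeasure (walk n (step m)) S"
      using d.emeasure_space_1 w.emeasure_space_1 True by (auto simp: walk_def space_PiM)
  qed (simp add: sets_walk)
next
  case False
  let ?\<tau> = "\<lambda>j. real j * step m"
  have \<tau>: "?\<tau> j < ?\<tau> (Suc j)" for j by simp
  have rv: "random_variable borel (\<lambda>\<omega>. incr m (\<lambda>t. W t \<omega>) j)" for j
    unfolding incr_def by (intro borel_measurable_diff random_variable_W) auto
  have "indep_vars (\<lambda>_. borel) (\<lambda>j \<omega>. incr m (\<lambda>t. W t \<omega>) j) {..<n}"
    unfolding incr_def by (rule indep_increments) (use \<tau> in auto)
  then have "distr M (PiM {..<n} (\<lambda>_. borel)) (\<lambda>\<omega>. \<lambda>j\<in>{..<n}. incr m (\<lambda>t. W t \<omega>) j)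
      = PiM {..<n} (\<lambda>j. distr M borel (\<lambda>\<omega>. incr m (\<lambda>t. W t \<omega>) j))"
    by (subst (asm) indep_vars_iff_distr_eq_PiM'[OF _ rv]) (use False in auto)
  moreover have "distr M borel (\<lambda>\<omega>. incr m (\<lambda>t. W t \<omega>) j) = gauss (step m)" for j
  proof -
    have "distributed M lborel (\<lambda>\<omega>. incr m (\<lambda>t. W t \<omega>) j)
        (\<lambda>x. ennreal (normal_density 0 (sqrt (?\<tau> (Suc j) - ?\<tau> j)) x))"
      unfolding incr_def by (rule normal_increments) (use \<tau> in auto)
    moreover have "?\<tau> (Suc j) - ?\<tau> j = step m" by (simp add: algebra_simps)
    ultimately have "distr M lborel (\<lambda>\<omega>. incr m (\<lambda>t. W t \<omega>) j) = gauss (step m)"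
      unfolding distributed_def gauss_def by simp
    then show ?thesis by (metis distr_cong sets_lborel)
  qed
  ultimately show ?thesis by (simp add: walk_def)
qed

theorem proposition3p5:
  fixes M :: "'a measure"
    and W :: "real \<Rightarrow> 'a \<Rightarrow> real"
    and L :: "real \<Rightarrow> real \<Rightarrow> 'a \<Rightarrow> real"
  assumes "wiener_process M W"
    and "is_local_time M W L"
  shows "equal_in_law
    (completion M) (\<lambda>t \<omega>. (running_max W t \<omega> - W t \<omega>, running_max W t \<omega>))
    (completion M) (\<lambda>t \<omega>. (\<bar>W t \<omega>\<bar>, L t 0 \<omega>))"
proof -
  interpret w: wiener_process M W by fact
  have incr_m: "(\<lambda>\<omega>. \<lambda>j\<in>{..<n}. incr m (\<lambda>t. W t \<omega>) j) \<in> measurable M (PiM {..<n} (\<lambda>_. borel))" for n m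
    unfolding incr_def by (intro measurable_restrict borel_measurable_diff w.random_variable_W) auto
  \<comment> \<open>The vector of grid increments is measurable for \<open>M\<close> itself, so its
    law does not change under completion.\<close>
  interpret c: discretized_wiener "completion M" W
  proof (intro discretized_wiener.intro discretized_wiener_axioms.intro)
    show "prob_space (completion M)" by (rule prob_spaceI) (simp add: w.emeasure_space_1)
    show "complete_measure (completion M)" by (rule completion.complete_measure_axioms)
    show "W t \<in> borel_measurable (completion M)" if "0 \<le> t" for t
      using w.random_variable_W[OF that] by (rule measurable_completion)
    show "AE \<omega> in completion M. W 0 \<omega> = 0 \<and> continuous_on {0..} (\<lambda>t. W t \<omega>)"
      unfolding AE_completion_iff using w.starts_at_0 w.continuous_paths by eventually_elim simp
    show "distr (completion M) (PiM {..<n} (\<lambda>_. borel)) (\<lambda>\<omega>. \<lambda>j\<in>{..<n}. incr m (\<lambda>t. W t \<omega>) j)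
        = walk n (step m)" for n m
      unfolding distr_completion[OF incr_m] by (rule w.increments_law)
  qed
  have L: "L t 0 \<in> borel_measurable (completion M)" if "0 \<le> t" for t
    using assms(2) that by (auto simp: is_local_time_def intro: measurable_completion)
  show ?thesis
  proof (rule c.levy_equal_in_law[where L="\<lambda>t. L t 0", OF L])
    fix t :: real assume t: "0 \<le> t"
    have good: "AE \<omega> in M. continuous_on {0..} (\<lambda>t. W t \<omega>) \<and> continuous_on UNIV (\<lambda>x. L t x \<omega>) \<and>
        (\<forall>x. 0 \<le> L t x \<omega>) \<and> (\<forall>A\<in>sets borel. (\<integral>\<^sup>+s\<in>{0..t}. indicator A (W s \<omega>) \<partial>lborel)
          = (\<integral>\<^sup>+x\<in>A. ennreal (L t x \<omega>) \<partial>lborel))"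
    proof -
      have "AE \<omega> in M. continuous_on ({0..} \<times> UNIV) (\<lambda>(t, x). L t x \<omega>)"
        "AE \<omega> in M. \<forall>t\<ge>0. (\<forall>x. 0 \<le> L t x \<omega>) \<and>
          (\<forall>A\<in>sets borel. occupation W t \<omega> A = (\<integral>\<^sup>+x\<in>A. ennreal (L t x \<omega>) \<partial>lborel))"
        using assms(2) by (auto simp: is_local_time_def)
      with w.continuous_paths show ?thesis
      proof eventually_elim
        case (elim \<omega>)
        \<comment> \<open>Restricting joint continuity to the line at time t makes the density
          continuous in space, which gives its value at 0 a meaning.\<close>
        have "continuous_on UNIV (\<lambda>x. (case (t, x) of (t, x) \<Rightarrow> L t x \<omega>))"
          by (rule continuous_on_compose2[OF elim(2), of UNIV "\<lambda>x. (t, x)"])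
             (use t in \<open>auto intro!: continuous_intros\<close>)
        with elim t show ?case by (simp add: occupation_def)
      qed
    qed
    show "tendsto_prob (completion M) (\<lambda>m \<omega>. walk_ltime (c.xi m \<omega>) (cnt m t)) (L t 0)"
    proof (rule c.walk_ltime_xi_tendsto_prob[OF t L[OF t]])
      show "AE \<omega> in completion M. (\<lambda>n. integral {0..t} (\<lambda>s. hat (step n) (W s \<omega>))) \<longlonglongrightarrow> 0"
        unfolding AE_completion_iff using good
      proof eventually_elim
        case (elim \<omega>)
        then show ?case by (intro hat_occupation_tendsto[OF _ _ _ t, of _ "\<lambda>x. L t x \<omega>"]) auto
      qed
      show "AE \<omega> in completion M. (\<lambda>n. integral {0..t} (\<lambda>s. bump (step n) (W s \<omega>)) / 2) \<longlonglongrightarrow> L t 0 \<omega>"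
        unfolding AE_completion_iff using good
      proof eventually_elim
        case (elim \<omega>)
        then show ?case by (intro bump_occupation_tendsto[OF _ _ _ t, of _ "\<lambda>x. L t x \<omega>"]) auto
      qed
    qed
  qed
qed

end
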